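(* Let $(M,g)$ be a smooth, compact, connected Riemannian manifold without boundary, let $V\in C^\infty(M,(0,\infty))$ satisfy $\|V\|_{L^\infty(M)}=1$, let $\omega\subset M$ be open and $T>0$. If $(\omega,T)$ satisfies (GCC$_V$), then for any $\epsilon,\delta>0$ the pair $(\omega_\delta,T+\epsilon)$ satisfies (GCC), where $\omega_\delta:=\{x\in M:\ \mathrm{dist}_g(x,\omega)<\delta\}$.
   Context: For a smooth real function $k$ on $T^*M$ (or on $T^*M$ minus the zero section), $\varphi^k_t$ denotes the flow of its Hamiltonian vector field $H_k=\sum_j \partial_{\xi_j}k\,\partial_{x_j}-\partial_{x_j}k\,\partial_{\xi_j}$ (canonical coordinates); $\pi_M:T^*M\to M$ is the canonical projection, $|\xi|_g$ the norm of a covector, $S^*M=\{(x,\xi)\in T^*M:\ |\xi|_g=1\}$, and $q(x,\xi):=\sqrt{|\xi|_g^2+V(x)}$ on $T^*M$. For an open set $\omega\subset M$ and $T>0$: - $(\omega,T)$ satisfies (GCC) if for every $\rho\in S^*M$ there is $t\in(0,T)$ with $\pi_M\circ\varphi_t^{|\xi|_g}(\rho)\in\omega$; - $(\omega,T)$ satisfies (GCC$_V$) if for every $\rho\in T^*M$ there is $t\in(0,T)$ with $\pi_M\circ\varphi_t^{q}(\rho)\in\omega$. *)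

theory Defs
  imports "HOL-Analysis.Analysis"
begin

section \<open>Smooth functions between open sets of normed spaces\<close>

text \<open>The set \<open>S\<close> is meant to be open; in finite dimension \<open>Ck_on k S f\<close> then says that \<open>f\<close> is
  \<open>k\<close> times continuously differentiable on \<open>S\<close>.\<close>

primrec Ck_on ::
  "nat \<Rightarrow> 'a::real_normed_vector set \<Rightarrow> ('a \<Rightarrow> 'b::real_normed_vector) \<Rightarrow> bool" where
  "Ck_on 0 S f \<longleftrightarrow> continuous_on S f"
| "Ck_on (Suc k) S f \<longleftrightarrow>
     (\<forall>x\<in>S. f differentiable (at x)) \<and>
     (\<forall>v. Ck_on k S (\<lambda>x. frechet_derivative f (at x) v))"

definition smooth_on ::
  "'a::real_normed_vector set \<Rightarrow> ('a \<Rightarrow> 'b::real_normed_vector) \<Rightarrow> bool" where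
  "smooth_on S f \<longleftrightarrow> (\<forall>k. Ck_on k S f)"


section \<open>Smooth manifolds\<close>

text \<open>The manifold is the whole type \<open>'m\<close> with its topology, its dimension is \<open>CARD('n)\<close>. A chart is a
  pair of its domain and its coordinate map; the values of the map outside the domain are irrelevant.
  A smooth structure is given by an atlas that need not be maximal; distances and the
  control conditions are the same for all atlases of one smooth structure.\<close>

type_synonym ('m, 'n) chart = "'m set \<times> ('m \<Rightarrow> real^'n)"

definition chart_inv :: "('m, 'n::finite) chart \<Rightarrow> real^'n \<Rightarrow> 'm" where
  "chart_inv c = inv_into (fst c) (snd c)"

definition is_chart :: "('m::topological_space, 'n::finite) chart \<Rightarrow> bool" where
  "is_chart c \<longleftrightarrow> open (fst c) \<and> open (snd c ` fst c) \<and>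
     homeomorphism (fst c) (snd c ` fst c) (snd c) (chart_inv c)"

definition smooth_atlas :: "('m::topological_space, 'n::finite) chart set \<Rightarrow> bool" where
  "smooth_atlas A \<longleftrightarrow>
     (\<forall>c\<in>A. is_chart c) \<and> (\<Union>c\<in>A. fst c) = UNIV \<and>
     (\<forall>c\<in>A. \<forall>d\<in>A. smooth_on (snd c ` (fst c \<inter> fst d)) (snd d \<circ> chart_inv c))"

definition smooth_function ::
  "('m, 'n::finite) chart set \<Rightarrow> ('m \<Rightarrow> 'b::real_normed_vector) \<Rightarrow> bool" where
  "smooth_function A f \<longleftrightarrow> (\<forall>c\<in>A. smooth_on (snd c ` fst c) (f \<circ> chart_inv c))"

definition chart_at :: "('m, 'n::finite) chart set \<Rightarrow> 'm \<Rightarrow> ('m, 'n) chart" where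
  "chart_at A p = (SOME c. c \<in> A \<and> p \<in> fst c)"

text \<open>Jacobian matrix at \<open>p\<close> of the change of coordinates from \<open>c\<close> to \<open>d\<close>.\<close>

definition jac :: "('m, 'n::finite) chart \<Rightarrow> ('m, 'n) chart \<Rightarrow> 'm \<Rightarrow> real^'n^'n" where
  "jac c d p = matrix (frechet_derivative (snd d \<circ> chart_inv c) (at (snd c p)))"

text \<open>Essential supremum of \<open>\<bar>f\<bar>\<close>. The null sets of the Riemannian volume are the sets that are
  Lebesgue null in all charts.\<close>

definition null_in_charts :: "('m, 'n::finite) chart set \<Rightarrow> 'm set \<Rightarrow> bool" where
  "null_in_charts A N \<longleftrightarrow> (\<forall>c\<in>A. negligible (snd c ` (N \<inter> fst c)))"

definition Linf_norm :: "('m, 'n::finite) chart set \<Rightarrow> ('m \<Rightarrow> real) \<Rightarrow> real" where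
  "Linf_norm A f = Inf {C. 0 \<le> C \<and> null_in_charts A {x. C < \<bar>f x\<bar>}}"


section \<open>Riemannian metrics and the distance\<close>

text \<open>\<open>G c p\<close> is the Gram matrix, at a point \<open>p\<close> of the domain of \<open>c\<close>, of the coordinate vector fields
  of \<open>c\<close>.\<close>

definition riemannian_metric ::
  "('m, 'n::finite) chart set \<Rightarrow> (('m, 'n) chart \<Rightarrow> 'm \<Rightarrow> real^'n^'n) \<Rightarrow> bool" where
  "riemannian_metric A G \<longleftrightarrow> (\<forall>c\<in>A.
     smooth_on (snd c ` fst c) (G c \<circ> chart_inv c) \<and>
     (\<forall>p\<in>fst c. transpose (G c p) = G c p \<and>
        (\<forall>v. v \<noteq> 0 \<longrightarrow> 0 < v \<bullet> (G c p *v v)) \<and>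
        (\<forall>d\<in>A. p \<in> fst d \<longrightarrow> G c p = transpose (jac c d p) ** G d p ** jac c d p)))"

text \<open>At the end points \<open>a\<close> and \<open>b\<close> the derivatives are one-sided.\<close>

definition C1_curve_on ::
  "('m::topological_space, 'n::finite) chart set \<Rightarrow> (real \<Rightarrow> 'm) \<Rightarrow> real \<Rightarrow> real \<Rightarrow> bool" where
  "C1_curve_on A \<gamma> a b \<longleftrightarrow> continuous_on {a..b} \<gamma> \<and>
     (\<forall>c\<in>A. let S = {t\<in>{a..b}. \<gamma> t \<in> fst c} in
        \<exists>D. continuous_on S D \<and>
            (\<forall>t\<in>S. ((snd c \<circ> \<gamma>) has_vector_derivative D t) (at t within S)))"

text \<open>\<open>P\<close> is the set of subdivision points.\<close>

definition piecewise_C1_curve ::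
  "('m::topological_space, 'n::finite) chart set \<Rightarrow> (real \<Rightarrow> 'm) \<Rightarrow> bool" where
  "piecewise_C1_curve A \<gamma> \<longleftrightarrow> (\<exists>P. finite P \<and> {0, 1} \<subseteq> P \<and> P \<subseteq> {0..1} \<and>
     (\<forall>a\<in>P. \<forall>b\<in>P. a < b \<and> {a<..<b} \<inter> P = {} \<longrightarrow> C1_curve_on A \<gamma> a b))"

definition speed ::
  "('m, 'n::finite) chart set \<Rightarrow> (('m, 'n) chart \<Rightarrow> 'm \<Rightarrow> real^'n^'n) \<Rightarrow>
    (real \<Rightarrow> 'm) \<Rightarrow> real \<Rightarrow> real" where
  "speed A G \<gamma> t =
     (let c = chart_at A (\<gamma> t); v = vector_derivative (snd c \<circ> \<gamma>) (at t)
      in sqrt (v \<bullet> (G c (\<gamma> t) *v v)))"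

definition riem_dist ::
  "('m::topological_space, 'n::finite) chart set \<Rightarrow> (('m, 'n) chart \<Rightarrow> 'm \<Rightarrow> real^'n^'n) \<Rightarrow>
    'm \<Rightarrow> 'm \<Rightarrow> real" where
  "riem_dist A G x y =
     Inf {integral {0..1} (speed A G \<gamma>) | \<gamma>. piecewise_C1_curve A \<gamma> \<and> \<gamma> 0 = x \<and> \<gamma> 1 = y}"

text \<open>The distance to a set is extended real, so that the distance to the empty set is \<open>\<infinity>\<close>.\<close>

definition riem_setdist ::
  "('m::topological_space, 'n::finite) chart set \<Rightarrow> (('m, 'n) chart \<Rightarrow> 'm \<Rightarrow> real^'n^'n) \<Rightarrow>
    'm \<Rightarrow> 'm set \<Rightarrow> ereal" where
  "riem_setdist A G x W = (INF y\<in>W. ereal (riem_dist A G x y))"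

definition nbhd_of ::
  "('m::topological_space, 'n::finite) chart set \<Rightarrow> (('m, 'n) chart \<Rightarrow> 'm \<Rightarrow> real^'n^'n) \<Rightarrow>
    'm set \<Rightarrow> real \<Rightarrow> 'm set" where
  "nbhd_of A G W \<delta> = {x. riem_setdist A G x W < ereal \<delta>}"


section \<open>The cotangent bundle\<close>

text \<open>A covector at \<open>p\<close> is the family of its components in the charts of the atlas around \<open>p\<close>, which
  are related by the covariant transformation law; at all other arguments the family is \<open>0\<close>.\<close>

type_synonym ('m, 'n) covec = "'m \<times> (('m, 'n) chart \<Rightarrow> real^'n)"

definition cotangent :: "('m, 'n::finite) chart set \<Rightarrow> ('m, 'n) covec set" where
  "cotangent A = {(p, \<xi>).
     (\<forall>c\<in>A. \<forall>d\<in>A. p \<in> fst c \<and> p \<in> fst d \<longrightarrow> \<xi> c = transpose (jac c d p) *v \<xi> d) \<and>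
     (\<forall>c. \<not> (c \<in> A \<and> p \<in> fst c) \<longrightarrow> \<xi> c = 0)}"

definition cotangent_nonzero :: "('m, 'n::finite) chart set \<Rightarrow> ('m, 'n) covec set" where
  "cotangent_nonzero A = {\<rho> \<in> cotangent A. snd \<rho> \<noteq> (\<lambda>_. 0)}"

text \<open>Canonical coordinates \<open>(x, \<xi>)\<close> of the cotangent bundle over the domain of the chart \<open>c\<close>, and their
  inverse.\<close>

definition cot_coords :: "('m, 'n::finite) chart \<Rightarrow> ('m, 'n) covec \<Rightarrow> (real^'n) \<times> (real^'n)" where
  "cot_coords c \<rho> = (snd c (fst \<rho>), snd \<rho> c)"

definition cot_inv ::
  "('m, 'n::finite) chart set \<Rightarrow> ('m, 'n) chart \<Rightarrow> (real^'n) \<times> (real^'n) \<Rightarrow> ('m, 'n) covec" where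
  "cot_inv A c = inv_into {\<rho> \<in> cotangent A. fst \<rho> \<in> fst c} (cot_coords c)"

definition conorm ::
  "('m, 'n::finite) chart set \<Rightarrow> (('m, 'n) chart \<Rightarrow> 'm \<Rightarrow> real^'n^'n) \<Rightarrow> ('m, 'n) covec \<Rightarrow> real" where
  "conorm A G \<rho> =
     (let c = chart_at A (fst \<rho>) in sqrt (snd \<rho> c \<bullet> (matrix_inv (G c (fst \<rho>)) *v snd \<rho> c)))"

definition cosphere ::
  "('m, 'n::finite) chart set \<Rightarrow> (('m, 'n) chart \<Rightarrow> 'm \<Rightarrow> real^'n^'n) \<Rightarrow> ('m, 'n) covec set" where
  "cosphere A G = {\<rho> \<in> cotangent A. conorm A G \<rho> = 1}"


section \<open>Hamiltonian flows\<close>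

text \<open>The components \<open>(\<partial>\<^sub>\<xi>k, -\<partial>\<^sub>xk)\<close> of the Hamiltonian vector field of \<open>k\<close> in the canonical
  coordinates over \<open>c\<close>.\<close>

definition ham_field ::
  "('m, 'n::finite) chart set \<Rightarrow> (('m, 'n) covec \<Rightarrow> real) \<Rightarrow> ('m, 'n) chart \<Rightarrow>
    (real^'n) \<times> (real^'n) \<Rightarrow> (real^'n) \<times> (real^'n)" where
  "ham_field A k c z =
     (let D = frechet_derivative (k \<circ> cot_inv A c) (at z)
      in (\<chi> j. D (0, axis j 1), \<chi> j. - D (axis j 1, 0)))"

text \<open>Integral curves, defined for all times, of the Hamiltonian vector field of a function \<open>k\<close> that is
  smooth on the open subset \<open>\<Omega>\<close> of the cotangent bundle. The continuity of the base point makes the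
  derivative in coordinates at \<open>t\<close> depend only on times at which the curve is over the domain of \<open>c\<close>.\<close>

definition ham_curve ::
  "('m::topological_space, 'n::finite) chart set \<Rightarrow> ('m, 'n) covec set \<Rightarrow>
    (('m, 'n) covec \<Rightarrow> real) \<Rightarrow> (real \<Rightarrow> ('m, 'n) covec) \<Rightarrow> bool" where
  "ham_curve A \<Omega> k \<gamma> \<longleftrightarrow>
     range \<gamma> \<subseteq> \<Omega> \<and> continuous_on UNIV (fst \<circ> \<gamma>) \<and>
     (\<forall>t. \<forall>c\<in>A. fst (\<gamma> t) \<in> fst c \<longrightarrow>
        ((cot_coords c \<circ> \<gamma>) has_vector_derivative ham_field A k c (cot_coords c (\<gamma> t))) (at t))"

text \<open>The graph of the flow: \<open>ham_flow A \<Omega> k t \<rho> \<sigma>\<close> says that the flow at time \<open>t\<close> maps \<open>\<rho>\<close> to \<open>\<sigma>\<close>.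
  On a compact manifold the two vector fields used below are complete (their Hamiltonians have compact
  level sets), so that for them \<open>\<sigma>\<close> exists and is unique for every \<open>t\<close> and every \<open>\<rho> \<in> \<Omega>\<close>.\<close>

definition ham_flow ::
  "('m::topological_space, 'n::finite) chart set \<Rightarrow> ('m, 'n) covec set \<Rightarrow>
    (('m, 'n) covec \<Rightarrow> real) \<Rightarrow> real \<Rightarrow> ('m, 'n) covec \<Rightarrow> ('m, 'n) covec \<Rightarrow> bool" where
  "ham_flow A \<Omega> k t \<rho> \<sigma> \<longleftrightarrow> (\<exists>\<gamma>. ham_curve A \<Omega> k \<gamma> \<and> \<gamma> 0 = \<rho> \<and> \<gamma> t = \<sigma>)"


section \<open>Geometric control conditions\<close>

definition GCC ::
  "('m::topological_space, 'n::finite) chart set \<Rightarrow> (('m, 'n) chart \<Rightarrow> 'm \<Rightarrow> real^'n^'n) \<Rightarrow>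
    'm set \<Rightarrow> real \<Rightarrow> bool" where
  "GCC A G W T \<longleftrightarrow>
     (\<forall>\<rho>\<in>cosphere A G. \<exists>t\<in>{0<..<T}. \<exists>\<sigma>.
        ham_flow A (cotangent_nonzero A) (conorm A G) t \<rho> \<sigma> \<and> fst \<sigma> \<in> W)"

definition q_ham ::
  "('m, 'n::finite) chart set \<Rightarrow> (('m, 'n) chart \<Rightarrow> 'm \<Rightarrow> real^'n^'n) \<Rightarrow> ('m \<Rightarrow> real) \<Rightarrow>
    ('m, 'n) covec \<Rightarrow> real" where
  "q_ham A G V \<rho> = sqrt ((conorm A G \<rho>)\<^sup>2 + V (fst \<rho>))"

definition GCC_V ::
  "('m::topological_space, 'n::finite) chart set \<Rightarrow> (('m, 'n) chart \<Rightarrow> 'm \<Rightarrow> real^'n^'n) \<Rightarrow>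
    ('m \<Rightarrow> real) \<Rightarrow> 'm set \<Rightarrow> real \<Rightarrow> bool" where
  "GCC_V A G V W T \<longleftrightarrow>
     (\<forall>\<rho>\<in>cotangent A. \<exists>t\<in>{0<..<T}. \<exists>\<sigma>.
        ham_flow A (cotangent A) (q_ham A G V) t \<rho> \<sigma> \<and> fst \<sigma> \<in> W)"

end

theory Submission
  imports Defs
begin

text \<open>At high frequency the flow of \<open>q\<close> is the geodesic flow: if \<open>(x, \<eta>)\<close> is an integral curve of \<open>q\<close>, then
  \<open>(x, h \<eta>)\<close> is one of \<open>sqrt (\<bar>\<xi>\<bar>\<^sup>2 + h\<^sup>2 V)\<close>, which tends to \<open>\<bar>\<xi>\<bar>\<close> as \<open>h \<rightarrow> 0\<close>. For \<open>\<rho>\<close> in the cosphere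
  bundle, the curves of \<open>q\<close> from \<open>\<rho> / h\<close>, which the hypothesis provides for all times, are rescaled in this
  way. Along an ultrafilter they converge pointwise: the base points because the manifold is
  compact, the covectors because energy is conserved. Over a chart, the linear approximation of the curves is
  uniform in \<open>h\<close>, so it passes to the limit, which is therefore a geodesic defined for all times; neither
  equicontinuity on the whole manifold nor uniqueness of geodesics is needed. The times at which the curves
  meet \<open>\<omega>\<close> converge in \<open>[0, T]\<close>, and the limit curve is then in the closure of \<open>\<omega>\<close>. A slightly later time
  avoids the time \<open>0\<close> and is still over the \<open>\<delta>\<close>-neighbourhood of \<open>\<omega>\<close>.\<close>

section \<open>Ultrafilters and matrix-valued functions\<close>

text \<open>A single ultrafilter finer than \<open>sequentially\<close> selects limits at all times
  at once; a diagonal extraction of subsequences reaches only countably many times.\<close>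

definition ultra :: "'a filter \<Rightarrow> bool" where
  "ultra F \<longleftrightarrow> F \<noteq> bot \<and> (\<forall>P. eventually P F \<or> eventually (\<lambda>x. \<not> P x) F)"

text \<open>Zorn's lemma for the proper filters below \<open>F\<close>, where a finer filter counts
  as larger. A finest one decides every predicate: restricting it to \<open>P\<close> either makes
  it trivial or does not change it.\<close>

lemma ultra_exists:
  fixes F :: "'a filter"
  assumes "F \<noteq> bot"
  shows "\<exists>U. U \<le> F \<and> ultra U"
proof -
  let ?A = "{G. G \<noteq> bot \<and> G \<le> F}"
  have "\<exists>U \<in> ?A. \<forall>G \<in> ?A. G \<le> U \<longrightarrow> G = U"
  proof (rule predicate_Zorn)
    show "partial_order_on ?A (relation_of (\<lambda>x y. y \<le> x) ?A)"
      by (rule partial_order_on_relation_ofI) auto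
    fix C assume C: "C \<in> Chains (relation_of (\<lambda>x y. y \<le> x) ?A)"
    show "\<exists>u\<in>?A. \<forall>a\<in>C. u \<le> a"
    proof (cases "C = {}")
      case True
      then show ?thesis using assms by auto
    next
      case False
      have CA: "C \<subseteq> ?A" and tot: "\<And>G H. G \<in> C \<Longrightarrow> H \<in> C \<Longrightarrow> G \<le> H \<or> H \<le> G"
        using C unfolding Chains_def relation_of_def by blast+
      \<comment> \<open>Along a nonempty chain, an event of the infimum is already an event of one
        member, so the infimum inherits properness.\<close>
      have "eventually P (Inf C) \<longleftrightarrow> (\<exists>b\<in>C. eventually P b)" for P
        by (rule eventually_Inf_base[OF False]) (use tot in \<open>metis inf.absorb1 inf.absorb2 order_refl\<close>)
      moreover have "\<not> eventually (\<lambda>_. False) b" if "b \<in> C" for b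
        using CA that by (auto simp: trivial_limit_def[symmetric])
      ultimately have "Inf C \<noteq> bot"
        unfolding trivial_limit_def by auto
      moreover have "Inf C \<le> F"
      proof -
        obtain b where "b \<in> C" using False by blast
        then have "Inf C \<le> b" "b \<le> F" using CA by (auto intro: Inf_lower)
        then show ?thesis by (rule order_trans)
      qed
      ultimately show ?thesis by (auto intro: Inf_lower)
    qed
  qed
  then obtain U where U: "U \<noteq> bot" "U \<le> F"
    and min: "\<And>G. G \<noteq> bot \<Longrightarrow> G \<le> F \<Longrightarrow> G \<le> U \<Longrightarrow> G = U" by auto
  have "eventually P U \<or> eventually (\<lambda>x. \<not> P x) U" for P
  proof (cases "inf U (principal {x. P x}) = bot")
    case True
    then have "eventually (\<lambda>x. \<not> P x) U"
      unfolding trivial_limit_def eventually_inf_principal by simp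
    then show ?thesis ..
  next
    case False
    have "inf U (principal {x. P x}) = U"
      using min[OF False] U(2) by (meson inf.coboundedI1 inf.cobounded1)
    then have "U \<le> principal {x. P x}" by (metis inf.cobounded2)
    then show ?thesis unfolding le_principal by simp
  qed
  then show ?thesis using U unfolding ultra_def by blast
qed

text \<open>If no point of \<open>K\<close> were a limit, each would have a neighbourhood that
  \<open>f\<close> eventually avoids, because \<open>F\<close> decides membership. Finitely many of
  these cover \<open>K\<close>, so \<open>f\<close> would eventually avoid \<open>K\<close>.\<close>

lemma ultra_compact_limit:
  fixes f :: "'a \<Rightarrow> 'b::topological_space"
  assumes "ultra F" and K: "compact K" and ev: "eventually (\<lambda>n. f n \<in> K) F"
  shows "\<exists>l\<in>K. (f \<longlongrightarrow> l) F"
proof (rule ccontr)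
  assume no: "\<not> ?thesis"
  have "\<exists>S. open S \<and> l \<in> S \<and> eventually (\<lambda>n. f n \<notin> S) F" if l: "l \<in> K" for l
  proof -
    from no l obtain S where "open S" "l \<in> S" "\<not> eventually (\<lambda>n. f n \<in> S) F"
      unfolding tendsto_def by blast
    then show ?thesis using assms(1) unfolding ultra_def by blast
  qed
  then obtain S where S: "\<And>l. l \<in> K \<Longrightarrow> open (S l) \<and> l \<in> S l \<and> eventually (\<lambda>n. f n \<notin> S l) F"
    by metis
  then have "\<forall>l\<in>K. open (S l)" "K \<subseteq> (\<Union>l\<in>K. S l)" by auto
  then obtain D where D: "D \<subseteq> K" "finite D" "K \<subseteq> (\<Union>l\<in>D. S l)"
    using compactE_image[OF K] by metis
  have "eventually (\<lambda>n. \<forall>l\<in>D. f n \<notin> S l) F"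
    using D S by (intro eventually_ball_finite) auto
  with ev have "eventually (\<lambda>n. False) F"
    by eventually_elim (use D in auto)
  then show False using assms(1) unfolding ultra_def trivial_limit_def by blast
qed

section \<open>Derivatives and inverses of matrix-valued functions\<close>

lemma smooth_onD:
  assumes "smooth_on S f"
  shows "x \<in> S \<Longrightarrow> f differentiable (at x)"
    and "continuous_on S (\<lambda>x. frechet_derivative f (at x) v)"
    and "continuous_on S f"
proof -
  have "Ck_on (Suc 0) S f" using assms unfolding smooth_on_def by blast
  then show *: "x \<in> S \<Longrightarrow> f differentiable (at x)"
    and "continuous_on S (\<lambda>x. frechet_derivative f (at x) v)" for x v by simp_all
  show "continuous_on S f"
    using * by (meson continuous_at_imp_continuous_on differentiable_imp_continuous_within)
qed

lemma inner_transpose: "x \<bullet> (transpose (B :: real^'n::finite^'m::finite) *v y) = (B *v x) \<bullet> y"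
  by (metis dot_lmul_matrix inner_commute transpose_matrix_vector)

text \<open>Near \<open>a\<close>, \<open>f\<close> is bounded by a multiple of the distance to
  \<open>a\<close>, and \<open>Q\<close> tends to 0, so the product is of smaller order than the
  distance. \<open>Q\<close> is merely continuous because it will contain an inverse matrix.\<close>

lemma has_derivative_inner_zero:
  fixes f Q :: "'a::real_normed_vector \<Rightarrow> 'b::real_inner"
  assumes f: "(f has_derivative f') (at a)" "f a = 0"
    and Q: "isCont Q a" "Q a = 0"
  shows "((\<lambda>x. f x \<bullet> Q x) has_derivative (\<lambda>_. 0)) (at a)"
proof -
  obtain B where B: "B > 0" "\<And>v. norm (f' v) \<le> norm v * B"
    using bounded_linear.pos_bounded[OF has_derivative_bounded_linear[OF f(1)]] by metis
  \<comment> \<open>In \<open>B + 1\<close>, \<open>B\<close> bounds the derivative and 1 is the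
    tolerance chosen for the remainder.\<close>
  have ev: "eventually (\<lambda>x. norm (f x) \<le> (B + 1) * norm (x - a)) (at a)"
  proof -
    obtain d where d: "d > 0"
      "\<And>y. norm (y - a) < d \<Longrightarrow> norm (f y - f a - f' (y - a)) \<le> 1 * norm (y - a)"
      using f(1)[unfolded has_derivative_at_alt] zero_less_one by blast
    have "norm (f y) \<le> (B + 1) * norm (y - a)" if "norm (y - a) < d" for y
    proof -
      have "norm (f y) \<le> norm (f y - f' (y - a)) + norm (f' (y - a))"
        by (metis diff_add_cancel norm_triangle_ineq)
      then show ?thesis using d(2)[OF that] B(2)[of "y - a"] f(2) by (simp add: algebra_simps)
    qed
    then show ?thesis unfolding eventually_at using d(1) by (auto simp: dist_norm)
  qed
  have "((\<lambda>x. (B + 1) * norm (Q x)) \<longlongrightarrow> (B + 1) * norm (0::'b)) (at a)"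
    using Q unfolding isCont_def by (intro tendsto_mult tendsto_const tendsto_norm) simp
  then have lim: "((\<lambda>x. (B + 1) * norm (Q x)) \<longlongrightarrow> 0) (at a)" by simp
  have ev2: "eventually (\<lambda>x. norm (norm (f x \<bullet> Q x) / norm (x - a)) \<le> (B + 1) * norm (Q x)) (at a)"
    using ev eventually_neq_at_within[of a a UNIV]
  proof eventually_elim
    case (elim x)
    have "norm (f x \<bullet> Q x) \<le> norm (f x) * norm (Q x)" using Cauchy_Schwarz_ineq2 by auto
    also have "\<dots> \<le> ((B + 1) * norm (x - a)) * norm (Q x)"
      by (rule mult_right_mono[OF elim(1)]) simp
    finally show ?case using elim(2) by (simp add: field_simps)
  qed
  have "((\<lambda>x. norm (f x \<bullet> Q x) / norm (x - a)) \<longlongrightarrow> 0) (at a)"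
    by (rule Lim_null_comparison[OF ev2 lim])
  then show ?thesis
    unfolding has_derivative_iff_norm using f(2) by simp
qed

lemma isCont_det:
  fixes M :: "'a::t2_space \<Rightarrow> real^'n^'n::finite"
  assumes "isCont M a"
  shows "isCont (\<lambda>x. det (M x)) a"
  unfolding det_def isCont_def
  by (intro tendsto_sum tendsto_mult tendsto_const tendsto_prod tendsto_vec_nth assms[unfolded isCont_def])

lemma isCont_matrix_vector_mult:
  fixes M :: "'a::t2_space \<Rightarrow> real^'n::finite^'m::finite"
  assumes "isCont M a" "isCont f a"
  shows "isCont (\<lambda>x. M x *v f x) a"
  unfolding matrix_vector_mult_def isCont_def
  by (intro tendsto_sum tendsto_mult tendsto_vec_lambda tendsto_vec_nth assms[unfolded isCont_def])

definition posdef :: "real^'n^'n::finite \<Rightarrow> bool" where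
  "posdef g \<longleftrightarrow> transpose g = g \<and> (\<forall>v. v \<noteq> 0 \<longrightarrow> 0 < v \<bullet> (g *v v))"

lemma posdef_invertible:
  assumes "posdef g" shows "invertible g"
proof -
  have "v = 0" if "g *v v = 0" for v
    using assms that unfolding posdef_def by fastforce
  then show ?thesis
    using invertible_left_inverse matrix_left_invertible_ker by blast
qed

lemma invertible_matrix_inv_vector:
  fixes g :: "real^'n^'n::finite"
  assumes "invertible g"
  shows "g *v (matrix_inv g *v v) = v" "matrix_inv g *v (g *v v) = v"
proof -
  have "g ** matrix_inv g = mat 1 \<and> matrix_inv g ** g = mat 1"
    using assms unfolding invertible_def matrix_inv_def by (rule someI_ex)
  then show "g *v (matrix_inv g *v v) = v" "matrix_inv g *v (g *v v) = v"
    by (simp_all add: matrix_vector_mul_assoc)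
qed

lemma matrix_inv_vector_unique:
  fixes g :: "real^'n^'n::finite"
  assumes "invertible g" "g *v u = v"
  shows "matrix_inv g *v v = u"
  using invertible_matrix_inv_vector(2)[OF assms(1)] assms(2) by blast

text \<open>Cramer's rule writes the vector as a quotient of determinants, which are continuous. It
  applies near \<open>a\<close>, where the determinant stays nonzero.\<close>

lemma isCont_matrix_inv_vector:
  fixes g :: "'a::metric_space \<Rightarrow> real^'n^'n::finite"
  assumes g: "isCont g a" and f: "isCont f a" and inv: "invertible (g a)"
  shows "isCont (\<lambda>x. matrix_inv (g x) *v f x) a"
proof -
  have d: "det (g a) \<noteq> 0" using inv invertible_det_nz by blast
  let ?h = "\<lambda>x. \<chi> k. det (\<chi> i j. if j = k then f x $ i else g x $ i $ j) / det (g x)"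
  have "isCont (\<lambda>x. \<chi> i j. if j = k then f x $ i else g x $ i $ j) a" for k
    unfolding isCont_def
    by (intro tendsto_vec_lambda)
      (use g f in \<open>auto simp: isCont_def intro!: tendsto_vec_nth\<close>)
  then have h: "isCont ?h a"
    unfolding isCont_def
    by (intro tendsto_vec_lambda tendsto_divide)
      (use isCont_det g d in \<open>auto simp: isCont_def\<close>)
  have "eventually (\<lambda>x. det (g x) \<noteq> 0) (at a)"
    using isCont_det[OF g] d unfolding isCont_def by (rule tendsto_imp_eventually_ne)
  then have ev: "eventually (\<lambda>x. det (g x) \<noteq> 0) (nhds a)"
    unfolding eventually_at_filter by eventually_elim (use d in auto)
  have e: "eventually (\<lambda>x. ?h x = matrix_inv (g x) *v f x) (nhds a)"
    using ev
  proof eventually_elim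
    case (elim x)
    have "invertible (g x)" using elim invertible_det_nz by blast
    then have "g x *v (matrix_inv (g x) *v f x) = f x"
      by (rule invertible_matrix_inv_vector)
    then show ?case by (rule cramer[OF elim, THEN iffD1, symmetric])
  qed
  then show ?thesis using h isCont_cong[OF e] by simp
qed

lemma bounded_linear_matrix_vector_left:
  "bounded_linear (\<lambda>M :: real^'n::finite^'m::finite. M *v u)"
  by (intro linear_conv_bounded_linear[THEN iffD1] linearI)
    (simp_all add: matrix_vector_mult_add_rdistrib scaleR_matrix_vector_assoc)

text \<open>Completion of the square around an arbitrary trial vector \<open>u\<close>; the last
  term measures how far \<open>u\<close> is from the dual vector of the covector. It serves both to
  differentiate the inverse form and to bound it from below.\<close>

lemma posdef_quadratic_split:
  fixes g :: "real^'n^'n::finite"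
  assumes "posdef g"
  shows "\<zeta> \<bullet> (matrix_inv g *v \<zeta>) = 2 * (\<zeta> \<bullet> u) - u \<bullet> (g *v u)
    + (\<zeta> - g *v u) \<bullet> (matrix_inv g *v (\<zeta> - g *v u))"
proof -
  define w where "w = matrix_inv g *v \<zeta>"
  have gw: "g *v w = \<zeta>" and "matrix_inv g *v (\<zeta> - g *v u) = w - u"
    using invertible_matrix_inv_vector[OF posdef_invertible[OF assms]]
    by (simp_all add: w_def matrix_vector_mult_diff_distrib)
  moreover have "(g *v u) \<bullet> w = u \<bullet> \<zeta>"
    using inner_transpose[of u g w] assms gw unfolding posdef_def by metis
  ultimately show ?thesis
    by (simp add: w_def[symmetric] inner_diff_left inner_diff_right inner_commute)
qed

text \<open>With \<open>u\<close> frozen in the splitting above, the last term vanishes to second order, so that the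
  derivative is found without differentiating the inverse matrix.\<close>

lemma has_derivative_matrix_inv_form:
  fixes g :: "real^'n \<Rightarrow> real^'n^'n::finite"
  assumes g: "(g has_derivative g') (at x)"
    and U: "open U" "x \<in> U" "\<And>y. y \<in> U \<Longrightarrow> posdef (g y)"
    and u: "u = matrix_inv (g x) *v \<xi>"
  shows "((\<lambda>z. snd z \<bullet> (matrix_inv (g (fst z)) *v snd z)) has_derivative
    (\<lambda>w. 2 * (snd w \<bullet> u) - u \<bullet> (g' (fst w) *v u))) (at (x, \<xi>))"
proof -
  define r where "r z = snd z - g (fst z) *v u" for z :: "(real^'n) \<times> (real^'n)"
  have g1: "((\<lambda>z. g (fst z)) has_derivative (\<lambda>w. g' (fst w))) (at (x, \<xi>))"
    by (rule has_derivative_compose[of fst, unfolded o_def])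
      (use g in \<open>auto intro!: derivative_intros\<close>)
  have gu: "((\<lambda>z. g (fst z) *v u) has_derivative (\<lambda>w. g' (fst w) *v u)) (at (x, \<xi>))"
    by (rule bounded_linear.has_derivative[OF bounded_linear_matrix_vector_left g1])
  have r: "(r has_derivative (\<lambda>w. snd w - g' (fst w) *v u)) (at (x, \<xi>))"
    unfolding r_def by (intro has_derivative_diff gu has_derivative_snd has_derivative_ident)
  have inv: "invertible (g x)" using U posdef_invertible by blast
  have r0: "r (x, \<xi>) = 0"
    by (simp add: r_def u invertible_matrix_inv_vector[OF inv])
  have gc: "isCont (\<lambda>z. g (fst z)) (x, \<xi>)" and rc: "isCont r (x, \<xi>)"
    using has_derivative_continuous[OF g1] has_derivative_continuous[OF r] by auto
  have Q: "isCont (\<lambda>z. matrix_inv (g (fst z)) *v r z) (x, \<xi>)"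
    using isCont_matrix_inv_vector[OF gc rc] inv by simp
  have R: "((\<lambda>z. r z \<bullet> (matrix_inv (g (fst z)) *v r z)) has_derivative (\<lambda>_. 0)) (at (x, \<xi>))"
    by (rule has_derivative_inner_zero[OF r r0 Q]) (simp add: r0)
  have "((\<lambda>z. (2 * (snd z \<bullet> u) - u \<bullet> (g (fst z) *v u)) + r z \<bullet> (matrix_inv (g (fst z)) *v r z))
      has_derivative (\<lambda>w. (2 * (snd w \<bullet> u) - u \<bullet> (g' (fst w) *v u)) + 0)) (at (x, \<xi>))"
    by (intro has_derivative_add R has_derivative_diff has_derivative_mult_right
      has_derivative_inner_left has_derivative_inner_right gu has_derivative_snd has_derivative_ident)
  then have "((\<lambda>z. (2 * (snd z \<bullet> u) - u \<bullet> (g (fst z) *v u)) + r z \<bullet> (matrix_inv (g (fst z)) *v r z))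
      has_derivative (\<lambda>w. 2 * (snd w \<bullet> u) - u \<bullet> (g' (fst w) *v u))) (at (x, \<xi>))"
    by simp
  then show ?thesis
  proof (rule has_derivative_transform_within_open)
    show "open (U \<times> (UNIV :: (real^'n) set))" "(x, \<xi>) \<in> U \<times> UNIV"
      using U by (auto intro: open_Times)
    fix z :: "(real^'n) \<times> (real^'n)" assume "z \<in> U \<times> UNIV"
    then have "posdef (g (fst z))" using U by auto
    from posdef_quadratic_split[OF this, of "snd z" u]
    show "2 * (snd z \<bullet> u) - u \<bullet> (g (fst z) *v u) + r z \<bullet> (matrix_inv (g (fst z)) *v r z)
      = snd z \<bullet> (matrix_inv (g (fst z)) *v snd z)"
      unfolding r_def by simp
  qed
qed

section \<open>The Hamiltonian in coordinates\<close>

text \<open>The weight \<open>s\<close> joins the two Hamiltonians: \<open>s = 0\<close> gives the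
  dual norm, \<open>s = 1\<close> gives \<open>q\<close>, and the curves of \<open>q\<close>
  rescaled by \<open>h\<close> have \<open>s = h\<^sup>2\<close>.\<close>

definition energy :: "(real^'n \<Rightarrow> real^'n^'n::finite) \<Rightarrow> (real^'n \<Rightarrow> real) \<Rightarrow> real \<Rightarrow>
    (real^'n) \<times> (real^'n) \<Rightarrow> real" where
  "energy g V s z = sqrt (snd z \<bullet> (matrix_inv (g (fst z)) *v snd z) + s * V (fst z))"

text \<open>The Hamiltonian vector field of \<open>energy g V s\<close> (see \<open>energy_field_eq\<close>); \<open>u\<close> is the dual vector of the
  covector, and the derivative of \<open>g\<inverse>\<close> is expressed by that of \<open>g\<close>.\<close>

definition energy_field :: "(real^'n \<Rightarrow> real^'n^'n::finite) \<Rightarrow> (real^'n \<Rightarrow> real) \<Rightarrow> real \<Rightarrow>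
    (real^'n) \<times> (real^'n) \<Rightarrow> (real^'n) \<times> (real^'n)" where
  "energy_field g V s z = (let u = matrix_inv (g (fst z)) *v snd z in
     ((1 / energy g V s z) *\<^sub>R u,
      \<chi> j. (u \<bullet> (frechet_derivative g (at (fst z)) (axis j 1) *v u)
          - s * frechet_derivative V (at (fst z)) (axis j 1)) / (2 * energy g V s z)))"

text \<open>The minus sign comes from differentiating an inverse matrix. Positivity of the energy
  keeps the square root differentiable.\<close>

lemma has_derivative_energy:
  fixes g :: "real^'n \<Rightarrow> real^'n^'n::finite"
  assumes g: "g differentiable (at (fst z))" and V: "V differentiable (at (fst z))"
    and U: "open U" "fst z \<in> U" "\<And>y. y \<in> U \<Longrightarrow> posdef (g y)"
    and pos: "0 < energy g V s z"
  defines "u \<equiv> matrix_inv (g (fst z)) *v snd z"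
  shows "(energy g V s has_derivative (\<lambda>w. (2 * (snd w \<bullet> u)
      - u \<bullet> (frechet_derivative g (at (fst z)) (fst w) *v u)
      + s * frechet_derivative V (at (fst z)) (fst w)) / (2 * energy g V s z))) (at z)"
proof -
  have g': "(g has_derivative frechet_derivative g (at (fst z))) (at (fst z))"
    and V': "(V has_derivative frechet_derivative V (at (fst z))) (at (fst z))"
    using g V frechet_derivative_works by blast+
  have V1: "((\<lambda>z. V (fst z)) has_derivative (\<lambda>w. frechet_derivative V (at (fst z)) (fst w))) (at z)"
    by (rule has_derivative_compose[of fst, unfolded o_def])
      (use V' in \<open>auto intro!: derivative_intros\<close>)
  have "((\<lambda>z. snd z \<bullet> (matrix_inv (g (fst z)) *v snd z)) has_derivative
    (\<lambda>w. 2 * (snd w \<bullet> u) - u \<bullet> (frechet_derivative g (at (fst z)) (fst w) *v u))) (at z)"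
    using has_derivative_matrix_inv_form[OF g' U, of u "snd z"] by (simp add: u_def)
  then have "((\<lambda>z. snd z \<bullet> (matrix_inv (g (fst z)) *v snd z) + s * V (fst z)) has_derivative
    (\<lambda>w. 2 * (snd w \<bullet> u) - u \<bullet> (frechet_derivative g (at (fst z)) (fst w) *v u)
      + s * frechet_derivative V (at (fst z)) (fst w))) (at z)"
    by (intro has_derivative_add has_derivative_mult_right V1)
  from has_derivative_real_sqrt[OF _ this] pos
  show ?thesis
    unfolding energy_def by (simp add: field_simps)
qed

lemma energy_field_eq:
  fixes g :: "real^'n \<Rightarrow> real^'n^'n::finite"
  assumes g: "g differentiable (at (fst z))" and V: "V differentiable (at (fst z))"
    and U: "open U" "fst z \<in> U" "\<And>y. y \<in> U \<Longrightarrow> posdef (g y)"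
    and pos: "0 < energy g V s z"
  defines "D \<equiv> frechet_derivative (energy g V s) (at z)"
  shows "((\<chi> j. D (0, axis j 1)), (\<chi> j. - D (axis j 1, 0))) = energy_field g V s z"
proof -
  define u where "u = matrix_inv (g (fst z)) *v snd z"
  have D: "D = (\<lambda>w. (2 * (snd w \<bullet> u)
      - u \<bullet> (frechet_derivative g (at (fst z)) (fst w) *v u)
      + s * frechet_derivative V (at (fst z)) (fst w)) / (2 * energy g V s z))"
    unfolding D_def u_def
    by (rule frechet_derivative_at[OF has_derivative_energy[OF g V U pos], symmetric])
  have g0: "frechet_derivative g (at (fst z)) 0 = 0" "frechet_derivative V (at (fst z)) 0 = 0"
    using g V by (meson frechet_derivative_works has_derivative_linear linear_0)+
  have a: "axis j 1 \<bullet> u = u $ j" for j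
    by (simp add: inner_axis' )
  show ?thesis
    unfolding D energy_field_def Let_def u_def[symmetric]
    using pos by (simp add: g0 a vec_eq_iff field_simps)
qed

text \<open>The form is homogeneous of degree 2 in the covector, so shrinking covectors by
  \<open>h\<close> weighs the potential with \<open>h\<^sup>2\<close>.\<close>

lemma energy_scale:
  fixes g :: "real^'n \<Rightarrow> real^'n^'n::finite"
  assumes h: "0 < h"
  shows "energy g V (h\<^sup>2) (x, \<xi>) = h * energy g V 1 (x, \<xi> /\<^sub>R h)"
proof -
  have u: "matrix_inv (g x) *v (\<xi> /\<^sub>R h) = (matrix_inv (g x) *v \<xi>) /\<^sub>R h"
    by (simp add: matrix_vector_mult_scaleR)
  have "energy g V 1 (x, \<xi> /\<^sub>R h) = sqrt ((\<xi> \<bullet> (matrix_inv (g x) *v \<xi>) + h\<^sup>2 * V x) / h\<^sup>2)"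
    using h unfolding energy_def fst_conv snd_conv u by (simp add: field_simps power2_eq_square)
  also have "\<dots> = energy g V (h\<^sup>2) (x, \<xi>) / h"
    using h by (simp add: energy_def real_sqrt_divide)
  finally show ?thesis using h by simp
qed

text \<open>Scaling covectors by \<open>h\<close> carries the field of \<open>q\<close> to the field
  with \<open>s = h\<^sup>2\<close> without a change of time: the base velocity is the same, and the
  covector velocity acquires the factor \<open>h\<close>.\<close>

lemma energy_field_scale:
  fixes g :: "real^'n \<Rightarrow> real^'n^'n::finite"
  assumes h: "0 < h"
  shows "energy_field g V (h\<^sup>2) (x, \<xi>)
    = (fst (energy_field g V 1 (x, \<xi> /\<^sub>R h)), h *\<^sub>R snd (energy_field g V 1 (x, \<xi> /\<^sub>R h)))"
proof -
  define u where "u = matrix_inv (g x) *v \<xi>"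
  have u: "matrix_inv (g x) *v (\<xi> /\<^sub>R h) = u /\<^sub>R h"
    by (simp add: u_def matrix_vector_mult_scaleR)
  define k where "k = energy g V 1 (x, \<xi> /\<^sub>R h)"
  have M: "B *v (c *\<^sub>R u) = c *\<^sub>R (B *v u)" for B :: "real^'n^'n" and c
    by (simp add: matrix_vector_mult_scaleR)
  \<comment> \<open>For \<open>k = 0\<close> both sides vanish by the convention for division by
    zero.\<close>
  show ?thesis
    unfolding energy_field_def Let_def fst_conv snd_conv u energy_scale[OF h] k_def[symmetric] u_def[symmetric]
    using h by (cases "k = 0") (simp_all add: vec_eq_iff M field_simps power2_eq_square)
qed

lemma isCont_chart_function:
  fixes z :: "'a::metric_space \<times> 'b::metric_space" and s :: real
  assumes "continuous_on U f" "open U" "fst z \<in> U"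
  shows "isCont (\<lambda>p. f (fst (snd p))) (s, z)"
proof -
  have "isCont f (fst z)" using assms continuous_on_eq_continuous_at by blast
  then show ?thesis
    by (intro isCont_o2[of "(s, z)" "\<lambda>p. fst (snd p)" f]) (auto intro!: continuous_intros)
qed

lemma isCont_dual_vector:
  fixes g :: "real^'n \<Rightarrow> real^'n^'n::finite" and s :: real
  assumes "continuous_on U g" "open U" "fst z \<in> U" "invertible (g (fst z))"
  shows "isCont (\<lambda>p. matrix_inv (g (fst (snd p))) *v snd (snd p)) (s, z)"
  by (rule isCont_matrix_inv_vector[OF isCont_chart_function[OF assms(1-3)]])
    (use assms(4) in \<open>auto intro!: continuous_intros\<close>)

lemma isCont_energy:
  fixes g :: "real^'n \<Rightarrow> real^'n^'n::finite"
  assumes "continuous_on U g" "continuous_on U V" "open U" "fst z \<in> U" "invertible (g (fst z))"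
  shows "isCont (\<lambda>p. energy g V (fst p) (snd p)) (s, z)"
  unfolding energy_def
  by (intro continuous_intros isCont_dual_vector[OF assms(1,3,4,5)]
    isCont_chart_function[OF assms(2,3,4)])

text \<open>Continuity is joint in \<open>s\<close> and \<open>z\<close>, since both move in the
  limit. At \<open>s = 0\<close> it is the source of the estimates that are uniform in small
  \<open>h\<close>.\<close>

lemma isCont_energy_field:
  fixes g :: "real^'n \<Rightarrow> real^'n^'n::finite"
  assumes g: "smooth_on U g" and V: "smooth_on U V" and U: "open U" "fst z \<in> U"
    and inv: "invertible (g (fst z))" and pos: "0 < energy g V s z"
  shows "isCont (\<lambda>p. energy_field g V (fst p) (snd p)) (s, z)"
proof -
  let ?p = "(s, z)"
  let ?u = "\<lambda>p. matrix_inv (g (fst (snd p))) *v snd (snd p)"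
  note u = isCont_dual_vector[OF smooth_onD(3)[OF g] U inv]
  note k = isCont_energy[OF smooth_onD(3)[OF g] smooth_onD(3)[OF V] U inv]
  note dg = isCont_chart_function[OF smooth_onD(2)[OF g] U]
  note dV = isCont_chart_function[OF smooth_onD(2)[OF V] U]
  have "isCont (\<lambda>p. (1 / energy g V (fst p) (snd p)) *\<^sub>R ?u p) ?p"
    by (intro continuous_intros u k) (use pos in auto)
  moreover have "isCont (\<lambda>p. \<chi> j. (?u p \<bullet> (frechet_derivative g (at (fst (snd p))) (axis j 1) *v ?u p)
      - fst p * frechet_derivative V (at (fst (snd p))) (axis j 1)) / (2 * energy g V (fst p) (snd p))) ?p"
  proof -
    have "isCont (\<lambda>p. (?u p \<bullet> (frechet_derivative g (at (fst (snd p))) (axis j 1) *v ?u p)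
      - fst p * frechet_derivative V (at (fst (snd p))) (axis j 1)) / (2 * energy g V (fst p) (snd p))) ?p" for j
      by (intro continuous_intros u k isCont_matrix_vector_mult dg dV) (use pos in auto)
    then show ?thesis unfolding isCont_def by (intro tendsto_vec_lambda)
  qed
  ultimately show ?thesis
    unfolding energy_field_def Let_def by (rule isCont_Pair)
qed

section \<open>Comparison of the metric with the Euclidean norm\<close>

text \<open>Passing to the dual vector \<open>u\<close> turns the inverse form at \<open>v\<close>
  into the form of \<open>g\<close> at \<open>u\<close>.\<close>

lemma posdef_inverse_form:
  assumes "posdef g"
  shows "0 \<le> v \<bullet> (matrix_inv g *v v)" "v \<noteq> 0 \<Longrightarrow> 0 < v \<bullet> (matrix_inv g *v v)"
proof -
  define u where "u = matrix_inv g *v v"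
  have gu: "g *v u = v"
    using invertible_matrix_inv_vector[OF posdef_invertible[OF assms]] by (simp add: u_def)
  have "v \<bullet> u = u \<bullet> (g *v u)" using gu by (simp add: inner_commute)
  moreover have "v \<noteq> 0 \<Longrightarrow> u \<noteq> 0" using gu by auto
  ultimately show "0 \<le> v \<bullet> (matrix_inv g *v v)" "v \<noteq> 0 \<Longrightarrow> 0 < v \<bullet> (matrix_inv g *v v)"
    using assms unfolding posdef_def u_def[symmetric]
    by (metis inner_zero_left less_eq_real_def)+
qed

text \<open>An upper bound for the operator norm that is visibly continuous in the matrix; the
  summand 1 keeps it away from zero.\<close>

definition entry_bound :: "real^'n^'n::finite \<Rightarrow> real" where
  "entry_bound g = 1 + (\<Sum>i\<in>UNIV. \<Sum>j\<in>UNIV. \<bar>g $ i $ j\<bar>)"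

lemma entry_bound_ge_1: "1 \<le> entry_bound g"
  unfolding entry_bound_def by (simp add: sum_nonneg)

lemma isCont_entry_bound: "isCont g a \<Longrightarrow> isCont (\<lambda>x. entry_bound (g x)) a"
  unfolding entry_bound_def isCont_def by (intro tendsto_intros)

lemma quadratic_form_le:
  "v \<bullet> (g *v v) \<le> entry_bound g * (norm v)\<^sup>2"
proof -
  have "v \<bullet> (g *v v) \<le> norm v * norm (g *v v)"
    by (rule norm_cauchy_schwarz)
  also have "\<dots> \<le> norm v * (onorm ((*v) g) * norm v)"
    by (intro mult_left_mono onorm) (auto simp: matrix_vector_mul_bounded_linear)
  also have "\<dots> \<le> norm v * (entry_bound g * norm v)"
    using onorm_le_matrix_component_sum[of g]
    by (intro mult_left_mono mult_right_mono) (auto simp: entry_bound_def)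
  finally show ?thesis by (simp add: power2_eq_square mult_ac)
qed

lemma norm_le_inverse_form:
  assumes "posdef g"
  shows "(norm v)\<^sup>2 \<le> entry_bound g * (v \<bullet> (matrix_inv g *v v))"
proof -
  define K where "K = entry_bound g"
  have K: "1 \<le> K" using entry_bound_ge_1 by (simp add: K_def)
  \<comment> \<open>This trial vector maximizes
    \<open>2 * (v \<bullet> u) - K * (norm u)\<^sup>2\<close>.\<close>
  define u where "u = (1 / K) *\<^sub>R v"
  have "v \<bullet> (matrix_inv g *v v) \<ge> 2 * (v \<bullet> u) - u \<bullet> (g *v u)"
    using posdef_quadratic_split[OF assms, of v u] posdef_inverse_form(1)[OF assms, of "v - g *v u"]
    by simp
  moreover have "u \<bullet> (g *v u) = (v \<bullet> (g *v v)) / K\<^sup>2"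
    by (simp add: u_def matrix_vector_mult_scaleR power2_eq_square)
  moreover have "(v \<bullet> (g *v v)) / K\<^sup>2 \<le> K * (norm v)\<^sup>2 / K\<^sup>2"
    using quadratic_form_le[of v g] by (intro divide_right_mono) (auto simp: K_def)
  moreover have "v \<bullet> u = (norm v)\<^sup>2 / K" by (simp add: u_def power2_norm_eq_inner)
  moreover have "K * (norm v)\<^sup>2 / K\<^sup>2 = (norm v)\<^sup>2 / K" by (simp add: power2_eq_square)
  ultimately have "(norm v)\<^sup>2 / K \<le> v \<bullet> (matrix_inv g *v v)" by simp
  then show ?thesis using K by (simp add: K_def field_simps)
qed

text \<open>A curve whose velocity stays close to \<open>w\<close> cannot leave the coordinate ball within unit time:
  at a first exit time it would still lie in the compact, hence closed, image of a smaller ball.\<close>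

lemma stays_in_chart_ball:
  fixes x :: "real \<Rightarrow> 'm::t2_space" and z :: "real \<Rightarrow> 'a::euclidean_space \<times> 'b::euclidean_space"
  assumes x: "continuous_on UNIV x" and W: "open W"
    and K: "compact K" "K \<subseteq> W"
    and inK: "\<And>t. x t \<in> W \<Longrightarrow> dist (z t) z0 \<le> 3 * \<eta> / 4 \<Longrightarrow> x t \<in> K"
    and \<eta>: "0 < \<eta>" and start: "x 0 \<in> W" "dist (z 0) z0 \<le> \<eta> / 2"
    and cont: "\<And>t. x t \<in> W \<Longrightarrow> isCont z t"
    and der: "\<And>t. t \<in> {0..1} \<Longrightarrow> x t \<in> W \<Longrightarrow> dist (z t) z0 < \<eta> \<Longrightarrow>
      (z has_vector_derivative D t) (at t) \<and> norm (D t - w) \<le> e"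
    and we: "norm w + e \<le> \<eta> / 4"
  shows "x 1 \<in> K \<and> norm (z 1 - z 0 - w) \<le> e"
proof -
  \<comment> \<open>The bootstrap condition: it is open in time, and as long as it holds the
    distance in fact stays below \<open>3 * \<eta> / 4\<close>.\<close>
  define good where "good t \<longleftrightarrow> x t \<in> W \<and> dist (z t) z0 < \<eta>" for t
  have good_open: "\<exists>d>0. \<forall>s. \<bar>s - t\<bar> < d \<longrightarrow> good s" if "good t" for t
  proof -
    have "isCont x t" using x continuous_on_eq_continuous_at by blast
    then have 1: "eventually (\<lambda>s. x s \<in> W) (nhds t)"
      using that W unfolding good_def isCont_def tendsto_at_iff_tendsto_nhds
      by (auto dest: topological_tendstoD)
    have "isCont z t" using cont that good_def by blast
    then have "isCont (\<lambda>s. dist (z s) z0) t" by (intro continuous_intros)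
    moreover have "dist (z t) z0 < \<eta>" using that good_def by blast
    ultimately have "eventually (\<lambda>s. dist (z s) z0 < \<eta>) (at t)"
      unfolding isCont_def by (metis order_tendstoD(2))
    then have 2: "eventually (\<lambda>s. dist (z s) z0 < \<eta>) (nhds t)"
      unfolding eventually_at_filter by eventually_elim (use \<open>dist (z t) z0 < \<eta>\<close> in auto)
    from 1 2 have "eventually good (nhds t)"
      unfolding good_def by eventually_elim auto
    then show ?thesis unfolding eventually_nhds_metric dist_real_def by blast
  qed
  \<comment> \<open>Mean value inequality for the deviation from the uniform motion with velocity
    \<open>w\<close>.\<close>
  have step: "norm (z b - z 0 - b *\<^sub>R w) \<le> b * e" if "0 \<le> b" "b \<le> 1" "\<And>t. 0 \<le> t \<Longrightarrow> t \<le> b \<Longrightarrow> good t" for b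
  proof -
    let ?f = "\<lambda>t. z t - t *\<^sub>R w"
    have "norm (?f b - ?f 0) \<le> e * norm (b - 0)"
    proof (rule differentiable_bound)
      show "convex {0..b}" by simp
      fix t assume t: "t \<in> {0..b}"
      have zD: "(z has_vector_derivative D t) (at t)" and De: "norm (D t - w) \<le> e"
        using der[of t] that(3)[of t] t that(2) unfolding good_def by auto
      have "((\<lambda>t. t *\<^sub>R w) has_vector_derivative w) (at t)"
        unfolding has_vector_derivative_def
        by (intro has_derivative_scaleR_left has_derivative_ident)
      then have "(?f has_vector_derivative (D t - w)) (at t)"
        by (rule has_vector_derivative_diff[OF zD])
      then show "(?f has_derivative (\<lambda>h. h *\<^sub>R (D t - w))) (at t within {0..b})"
        unfolding has_vector_derivative_def by (rule has_derivative_at_withinI)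
      show "onorm (\<lambda>h. h *\<^sub>R (D t - w)) \<le> e"
        by (rule onorm_le) (use De in \<open>simp add: mult.commute[of e] mult_left_mono\<close>)
    qed (use that in auto)
    then show ?thesis using that by (simp add: algebra_simps)
  qed
  \<comment> \<open>The starting point accounts for \<open>\<eta> / 2\<close> and the motion for at
    most \<open>\<eta> / 4\<close>.\<close>
  have close: "dist (z b) z0 \<le> 3 * \<eta> / 4"
    if "0 \<le> b" "b \<le> 1" "norm (z b - z 0 - b *\<^sub>R w) \<le> b * e" for b
  proof -
    have e: "0 \<le> e"
    proof -
      have "norm (D 0 - w) \<le> e" using der[of 0] start \<eta> by simp
      then show ?thesis using norm_ge_zero order_trans by blast
    qed
    have "norm (z b - z 0) \<le> norm (z b - z 0 - b *\<^sub>R w) + norm (b *\<^sub>R w)"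
      by (metis diff_add_cancel norm_triangle_ineq)
    also have "\<dots> \<le> 1 * e + 1 * norm w"
      using that e by (intro add_mono order_trans[OF that(3)] mult_right_mono) (auto intro: mult_left_le_one_le)
    finally have "dist (z b) (z 0) \<le> \<eta> / 4" using we by (simp add: dist_norm)
    then show ?thesis using start(2) dist_triangle[of "z b" z0 "z 0"] by simp
  qed
  have all_good: "good t" if t: "0 \<le> t" "t \<le> 1" for t
  proof (rule ccontr)
    assume bad: "\<not> good t"
    define B where "B = {s. 0 \<le> s \<and> s \<le> t \<and> \<not> good s}"
    define b where "b = Inf B"
    have B: "t \<in> B" "bdd_below B" using bad t by (auto simp: B_def intro!: bdd_belowI[of _ 0])
    have b: "0 \<le> b" "b \<le> t" unfolding b_def
      using B by (auto intro!: cInf_greatest cInf_lower simp: B_def)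
    have before: "good s" if "0 \<le> s" "s < b" for s
    proof (rule ccontr)
      assume "\<not> good s"
      then have "s \<in> B" using that b by (auto simp: B_def)
      then show False using that cInf_lower[OF _ B(2)] by (force simp: b_def)
    qed
    have nb: "\<not> good b"
    proof
      assume "good b"
      then obtain d where d: "d > 0" "\<And>s. \<bar>s - b\<bar> < d \<Longrightarrow> good s" using good_open by blast
      have "b + d \<le> s" if "s \<in> B" for s
      proof -
        have "b \<le> s" using that cInf_lower B by (simp add: b_def)
        moreover have "\<not> good s" using that by (simp add: B_def)
        ultimately show ?thesis using d(2)[of s] by force
      qed
      then have "b + d \<le> Inf B" using B by (intro cInf_greatest) auto
      then show False using d b_def by simp
    qed
    have "good 0" using start \<eta> by (simp add: good_def)
    then have b0: "0 < b" using nb b by (metis order_le_less)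
    have inK': "x s \<in> K" if "0 \<le> s" "s < b" for s
    proof (rule inK)
      show "x s \<in> W" using before that good_def by blast
      show "dist (z s) z0 \<le> 3 * \<eta> / 4"
        by (rule close[OF _ _ step]) (use that before b t in auto)
    qed
    \<comment> \<open>Continuity of \<open>z\<close> is known only at times when \<open>x\<close> is
      in \<open>W\<close>. So \<open>x b\<close> has to be placed in \<open>K\<close> first, by
      closedness, before \<open>z\<close> can be followed up to the time \<open>b\<close>.\<close>
    have "closed (x -` K)"
      using continuous_closed_vimage[OF compact_imp_closed[OF K(1)]] x
      by (metis continuous_on_eq_continuous_at open_UNIV UNIV_I)
    moreover have "{0..<b} \<subseteq> x -` K" using inK' by auto
    ultimately have "closure {0..<b} \<subseteq> x -` K" by (rule closure_minimal[rotated])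
    then have "{0..b} \<subseteq> x -` K" using b0 by (simp add: closure_atLeastLessThan)
    then have xb: "x b \<in> K" using b0 by (metis atLeastAtMost_iff less_imp_le order_refl subsetD vimageD)
    then have "isCont z b" using K(2) cont by blast
    then have "isCont (\<lambda>s. dist (z s) z0) b" by (intro continuous_intros)
    then have "((\<lambda>s. dist (z s) z0) \<longlongrightarrow> dist (z b) z0) (at_left b)"
      unfolding isCont_def by (rule filterlim_mono) (auto simp: at_le)
    moreover have "dist (z s) z0 \<le> 3 * \<eta> / 4" if s: "0 < s" "s < b" for s
      by (rule close[OF _ _ step]) (use s before b t in auto)
    then have "eventually (\<lambda>s. dist (z s) z0 \<le> 3 * \<eta> / 4) (at_left b)"
      unfolding eventually_at_left[OF b0] using b0 by blast
    ultimately have "dist (z b) z0 \<le> 3 * \<eta> / 4"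
      using tendsto_upperbound trivial_limit_at_left_real by blast
    then have "good b" using xb K(2) \<eta> unfolding good_def by auto
    then show False using nb by blast
  qed
  have "norm (z 1 - z 0 - w) \<le> e" using step[of 1] all_good by simp
  moreover have "x 1 \<in> K"
    using all_good[of 1] close[of 1] calculation by (intro inK) (auto simp: good_def)
  ultimately show ?thesis by blast
qed

section \<open>The cotangent bundle and the Hamiltonians\<close>

locale riemannian_atlas =
  fixes A :: "('m::t2_space, 'n::finite) chart set"
    and G :: "('m, 'n) chart \<Rightarrow> 'm \<Rightarrow> real^'n^'n"
  assumes atlas: "smooth_atlas A" and metric: "riemannian_metric A G"
begin

abbreviation gram :: "('m, 'n) chart \<Rightarrow> real^'n \<Rightarrow> real^'n^'n" where
  "gram c \<equiv> G c \<circ> chart_inv c"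

lemma chart:
  assumes "c \<in> A"
  shows "open (fst c)" "open (snd c ` fst c)"
    "continuous_on (fst c) (snd c)" "continuous_on (snd c ` fst c) (chart_inv c)"
    "p \<in> fst c \<Longrightarrow> chart_inv c (snd c p) = p"
    "x \<in> snd c ` fst c \<Longrightarrow> snd c (chart_inv c x) = x"
    "x \<in> snd c ` fst c \<Longrightarrow> chart_inv c x \<in> fst c"
  using assms atlas
  unfolding smooth_atlas_def is_chart_def homeomorphism_def by auto

lemma chart_at: "chart_at A p \<in> A" "p \<in> fst (chart_at A p)"
proof -
  have "p \<in> (\<Union>c\<in>A. fst c)" using atlas unfolding smooth_atlas_def by (metis UNIV_I)
  then have "\<exists>c. c \<in> A \<and> p \<in> fst c" by blast
  then have "chart_at A p \<in> A \<and> p \<in> fst (chart_at A p)"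
    unfolding chart_at_def by (rule someI_ex)
  then show "chart_at A p \<in> A" "p \<in> fst (chart_at A p)" by auto
qed

lemma open_chart_image:
  assumes c: "c \<in> A" and N: "open N"
  shows "open (snd c ` (fst c \<inter> N))"
proof -
  have "snd c ` (fst c \<inter> N) = snd c ` fst c \<inter> chart_inv c -` N"
    using chart(5-7)[OF c] by force
  then show ?thesis
    using continuous_open_preimage[OF chart(4)[OF c] chart(2)[OF c] N] by simp
qed

lemma open_chart_preimage:
  "c \<in> A \<Longrightarrow> open B \<Longrightarrow> open (fst c \<inter> snd c -` B)"
  by (rule continuous_open_preimage) (use chart in auto)

lemma gram_posdef: "c \<in> A \<Longrightarrow> p \<in> fst c \<Longrightarrow> posdef (G c p)"
  using metric unfolding riemannian_metric_def posdef_def by blast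

lemma gram_posdef': "c \<in> A \<Longrightarrow> x \<in> snd c ` fst c \<Longrightarrow> posdef (gram c x)"
  using gram_posdef chart(7) by auto

lemma gram_smooth: "c \<in> A \<Longrightarrow> smooth_on (snd c ` fst c) (gram c)"
  using metric unfolding riemannian_metric_def by blast

lemma gram_change:
  "c \<in> A \<Longrightarrow> d \<in> A \<Longrightarrow> p \<in> fst c \<Longrightarrow> p \<in> fst d \<Longrightarrow>
    G c p = transpose (jac c d p) ** G d p ** jac c d p"
  using metric unfolding riemannian_metric_def by blast

lemma transition_smooth:
  "c \<in> A \<Longrightarrow> d \<in> A \<Longrightarrow> smooth_on (snd c ` (fst c \<inter> fst d)) (snd d \<circ> chart_inv c)"
  using atlas unfolding smooth_atlas_def by blast

lemma transition_derivative:
  assumes "c \<in> A" "d \<in> A" "p \<in> fst c" "p \<in> fst d"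
  shows "((snd d \<circ> chart_inv c) has_derivative (*v) (jac c d p)) (at (snd c p))"
proof -
  have "(snd d \<circ> chart_inv c) differentiable (at (snd c p))"
    using smooth_onD(1)[OF transition_smooth[OF assms(1,2)]] assms by blast
  then have D: "((snd d \<circ> chart_inv c) has_derivative
      frechet_derivative (snd d \<circ> chart_inv c) (at (snd c p))) (at (snd c p))"
    using frechet_derivative_works by blast
  show ?thesis
    using D matrix_vector_mul(2)[OF has_derivative_linear[OF D]] by (simp add: jac_def)
qed

lemma jac_eqI:
  assumes "((snd d \<circ> chart_inv c) has_derivative (*v) J) (at (snd c p))"
  shows "jac c d p = J"
  unfolding jac_def frechet_derivative_at[OF assms, symmetric] by (rule matrix_of_matrix_vector_mul)

text \<open>Chain rule: on the overlap of \<open>c\<close> and \<open>d\<close>, passing through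
  \<open>d\<close> does not alter the coordinate change from \<open>c\<close> to
  \<open>e\<close>.\<close>

lemma jac_cocycle:
  assumes "c \<in> A" "d \<in> A" "e \<in> A" "p \<in> fst c" "p \<in> fst d" "p \<in> fst e"
  shows "jac c e p = jac d e p ** jac c d p"
proof (rule jac_eqI)
  have eq: "(snd d \<circ> chart_inv c) (snd c p) = snd d p" using chart(5) assms by simp
  have "((snd e \<circ> chart_inv d) has_derivative (*v) (jac d e p)) (at ((snd d \<circ> chart_inv c) (snd c p)))"
    unfolding eq by (rule transition_derivative) (use assms in auto)
  from diff_chain_at[OF transition_derivative[OF assms(1,2,4,5)] this]
  have "((snd e \<circ> chart_inv d) \<circ> (snd d \<circ> chart_inv c) has_derivative
      (*v) (jac d e p ** jac c d p)) (at (snd c p))"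
    by (simp add: o_def matrix_vector_mul_assoc)
  then show "((snd e \<circ> chart_inv c) has_derivative (*v) (jac d e p ** jac c d p)) (at (snd c p))"
  proof (rule has_derivative_transform_within_open)
    show "open (snd c ` (fst c \<inter> fst d))" using assms open_chart_image chart(1) by blast
    show "snd c p \<in> snd c ` (fst c \<inter> fst d)" using assms by blast
    fix x assume "x \<in> snd c ` (fst c \<inter> fst d)"
    then show "((snd e \<circ> chart_inv d) \<circ> (snd d \<circ> chart_inv c)) x = (snd e \<circ> chart_inv c) x"
      using chart(5)[OF assms(1)] chart(5)[OF assms(2)] by auto
  qed
qed

lemma jac_self:
  assumes "c \<in> A" "p \<in> fst c"
  shows "jac c c p = mat 1"
proof (rule jac_eqI)
  have "(*v) (mat 1 :: real^'n^'n) = (\<lambda>x. x)" by (simp add: fun_eq_iff)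
  then have "((\<lambda>x. x) has_derivative (*v) (mat 1 :: real^'n^'n)) (at (snd c p))"
    by (simp only: has_derivative_ident)
  then show "((snd c \<circ> chart_inv c) has_derivative (*v) (mat 1)) (at (snd c p))"
    by (rule has_derivative_transform_within_open[OF _ chart(2)[OF assms(1)]])
      (use assms chart(6) in auto)
qed

lemma jac_inverse:
  assumes "c \<in> A" "d \<in> A" "p \<in> fst c" "p \<in> fst d"
  shows "jac d c p ** jac c d p = mat 1"
  using jac_cocycle[of c d c p] jac_self assms by simp

text \<open>The filter is arbitrary because the lemma serves both along the ultrafilter and along a
  curve at a given time.\<close>

lemma tendsto_jac:
  assumes cd: "c \<in> A" "d \<in> A" "p \<in> fst c" "p \<in> fst d" and y: "(y \<longlongrightarrow> p) F"
  shows "((\<lambda>n. jac c d (y n)) \<longlongrightarrow> jac c d p) F"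
proof -
  let ?S = "snd c ` (fst c \<inter> fst d)"
  have "(y \<longlongrightarrow> p) F" "eventually (\<lambda>n. y n \<in> fst c) F"
    using y topological_tendstoD chart(1) cd by blast+
  then have "((\<lambda>n. snd c (y n)) \<longlongrightarrow> snd c p) F"
    using continuous_on_tendsto_compose[OF chart(3)[OF cd(1)]] cd by blast
  moreover have "isCont (\<lambda>x. frechet_derivative (snd d \<circ> chart_inv c) (at x) v) (snd c p)" for v
    using smooth_onD(2)[OF transition_smooth[OF cd(1,2)]] open_chart_image[OF cd(1) chart(1)[OF cd(2)]] cd
      continuous_on_eq_continuous_at by blast
  ultimately have "((\<lambda>n. frechet_derivative (snd d \<circ> chart_inv c) (at (snd c (y n))) v)
      \<longlongrightarrow> frechet_derivative (snd d \<circ> chart_inv c) (at (snd c p)) v) F" for v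
    by (rule isCont_tendsto_compose[rotated])
  then show ?thesis
    unfolding jac_def matrix_def by (intro tendsto_vec_lambda tendsto_vec_nth)
qed

section \<open>Covectors and their norm\<close>

lemma cotangentD:
  assumes "\<rho> \<in> cotangent A"
  shows "c \<in> A \<Longrightarrow> d \<in> A \<Longrightarrow> fst \<rho> \<in> fst c \<Longrightarrow> fst \<rho> \<in> fst d \<Longrightarrow>
      snd \<rho> c = transpose (jac c d (fst \<rho>)) *v snd \<rho> d"
    and "\<not> (c \<in> A \<and> fst \<rho> \<in> fst c) \<Longrightarrow> snd \<rho> c = 0"
  using assms unfolding cotangent_def case_prod_beta mem_Collect_eq by blast+

text \<open>The transformation law is linear. This supplies the starting covectors, which are
  \<open>\<rho>\<close> divided by \<open>h n\<close>.\<close>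

lemma cotangent_scale:
  assumes "\<rho> \<in> cotangent A"
  shows "(fst \<rho>, \<lambda>c. a *\<^sub>R snd \<rho> c) \<in> cotangent A"
  unfolding cotangent_def case_prod_conv mem_Collect_eq
proof (intro conjI ballI allI impI)
  fix c d assume "c \<in> A" "d \<in> A" "fst \<rho> \<in> fst c \<and> fst \<rho> \<in> fst d"
  then have "snd \<rho> c = transpose (jac c d (fst \<rho>)) *v snd \<rho> d"
    using cotangentD(1)[OF assms] by blast
  then show "a *\<^sub>R snd \<rho> c = transpose (jac c d (fst \<rho>)) *v (a *\<^sub>R snd \<rho> d)"
    by (simp only: matrix_vector_mult_scaleR)
qed (use cotangentD(2)[OF assms] in simp)

text \<open>\<open>conorm\<close> is defined through a chosen chart. Dual vectors transform by the
  Jacobian \<open>J\<close> and covectors by its transpose, so their pairing is the same in all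
  charts.\<close>

lemma conorm_chart:
  assumes \<rho>: "\<rho> \<in> cotangent A" and d: "d \<in> A" "fst \<rho> \<in> fst d"
  shows "conorm A G \<rho> = sqrt (snd \<rho> d \<bullet> (matrix_inv (G d (fst \<rho>)) *v snd \<rho> d))"
proof -
  obtain p \<xi> where p: "\<rho> = (p, \<xi>)" by (cases \<rho>)
  define c where "c = chart_at A p"
  have c: "c \<in> A" "p \<in> fst c" using chart_at by (auto simp: c_def)
  have d': "d \<in> A" "p \<in> fst d" using d p by auto
  define J where "J = jac c d p"
  have law: "\<xi> c = transpose J *v \<xi> d"
    using cotangentD(1)[OF \<rho>, of c d] c d' by (simp add: p J_def del: transpose_matrix_vector)
  have JJ: "jac d c p ** J = mat 1" unfolding J_def by (rule jac_inverse) (use c d' in auto)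
  have inj: "a = b" if "transpose J *v a = transpose J *v b" for a b
  proof -
    have "transpose (J ** jac d c p) *v a = transpose (J ** jac d c p) *v b"
      using that by (simp add: matrix_transpose_mul matrix_vector_mul_assoc[symmetric] del: transpose_matrix_vector)
    moreover have "J ** jac d c p = mat 1" using JJ matrix_left_right_inverse by blast
    ultimately show ?thesis by (simp add: transpose_mat del: transpose_matrix_vector)
  qed
  define u where "u = matrix_inv (G c p) *v \<xi> c"
  have "G c p *v u = \<xi> c"
    unfolding u_def by (rule invertible_matrix_inv_vector posdef_invertible gram_posdef c)+
  then have "transpose J *v (G d p *v (J *v u)) = transpose J *v \<xi> d"
    using law gram_change[OF c(1) d'(1) c(2) d'(2)] by (simp add: J_def matrix_vector_mul_assoc matrix_mul_assoc del: transpose_matrix_vector)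
  then have "G d p *v (J *v u) = \<xi> d" by (rule inj)
  then have "matrix_inv (G d p) *v \<xi> d = J *v u"
    by (intro matrix_inv_vector_unique posdef_invertible gram_posdef d')
  moreover have "\<xi> c \<bullet> u = \<xi> d \<bullet> (J *v u)"
    unfolding law using inner_transpose[of u J "\<xi> d"] by (metis inner_commute)
  ultimately show ?thesis
    unfolding conorm_def Let_def p using c_def u_def by simp
qed

lemma conorm_nonneg: "0 \<le> conorm A G \<rho>"
  unfolding conorm_def Let_def
  by (intro real_sqrt_ge_zero posdef_inverse_form(1) gram_posdef chart_at)

lemma conorm_square:
  assumes "\<rho> \<in> cotangent A" "d \<in> A" "fst \<rho> \<in> fst d"
  shows "(conorm A G \<rho>)\<^sup>2 = snd \<rho> d \<bullet> (matrix_inv (G d (fst \<rho>)) *v snd \<rho> d)"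
  unfolding conorm_chart[OF assms]
  by (intro real_sqrt_pow2 posdef_inverse_form(1) gram_posdef assms)

text \<open>The components in \<open>c\<close> are transported to the other charts by the Jacobians;
  the cocycle identity makes the resulting family compatible.\<close>

lemma covector_exists:
  assumes c: "c \<in> A" "p \<in> fst c"
  shows "\<exists>\<rho>\<in>cotangent A. fst \<rho> = p \<and> snd \<rho> c = \<xi>"
proof -
  let ?\<xi> = "\<lambda>d. if d \<in> A \<and> p \<in> fst d then transpose (jac d c p) *v \<xi> else 0"
  have "(p, ?\<xi>) \<in> cotangent A"
    unfolding cotangent_def case_prod_conv mem_Collect_eq
  proof (intro conjI ballI impI allI)
    fix d e assume "d \<in> A" "e \<in> A" "p \<in> fst d \<and> p \<in> fst e"
    then show "?\<xi> d = transpose (jac d e p) *v ?\<xi> e"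
      using jac_cocycle[of d e c p] c
      by (simp add: matrix_transpose_mul matrix_vector_mul_assoc del: transpose_matrix_vector)
  qed auto
  moreover have "?\<xi> c = \<xi>" using c jac_self by (simp add: transpose_mat del: transpose_matrix_vector)
  ultimately show ?thesis by (intro bexI[of _ "(p, ?\<xi>)"]) auto
qed

lemma covector_unique:
  assumes "c \<in> A" "\<rho> \<in> cotangent A" "\<sigma> \<in> cotangent A" "fst \<rho> \<in> fst c" "fst \<rho> = fst \<sigma>"
    "snd \<rho> c = snd \<sigma> c"
  shows "\<rho> = \<sigma>"
proof -
  have "snd \<rho> d = snd \<sigma> d" for d
  proof (cases "d \<in> A \<and> fst \<rho> \<in> fst d")
    case True
    then have "snd \<rho> d = transpose (jac d c (fst \<rho>)) *v snd \<rho> c"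
      "snd \<sigma> d = transpose (jac d c (fst \<rho>)) *v snd \<sigma> c"
      using cotangentD(1)[OF assms(2), of d c] cotangentD(1)[OF assms(3), of d c] assms by auto
    then show ?thesis using assms(6) by simp
  next
    case False
    then show ?thesis using cotangentD(2)[of _ d] assms by metis
  qed
  then have "snd \<rho> = snd \<sigma>" by (rule ext)
  with assms(5) show ?thesis by (rule prod_eqI)
qed

text \<open>\<open>cot_inv\<close> is an \<open>inv_into\<close>, so these facts rest on existence
  and uniqueness of the covector with given components.\<close>

lemma cot_inv:
  assumes c: "c \<in> A" and x: "x \<in> snd c ` fst c"
  shows "cot_inv A c (x, \<xi>) \<in> cotangent A" "fst (cot_inv A c (x, \<xi>)) = chart_inv c x"
    "snd (cot_inv A c (x, \<xi>)) c = \<xi>"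
proof -
  let ?S = "{\<rho> \<in> cotangent A. fst \<rho> \<in> fst c}"
  obtain \<rho> where \<rho>: "\<rho> \<in> cotangent A" "fst \<rho> = chart_inv c x" "snd \<rho> c = \<xi>"
    using covector_exists[OF c chart(7)[OF c x]] by blast
  have "cot_coords c \<rho> = (x, \<xi>)" using \<rho> chart(6)[OF c x] by (simp add: cot_coords_def)
  moreover have "\<rho> \<in> ?S" using \<rho> chart(7)[OF c x] by simp
  moreover have "inj_on (cot_coords c) ?S"
  proof (rule inj_onI)
    fix \<rho> \<sigma> assume *: "\<rho> \<in> ?S" "\<sigma> \<in> ?S" "cot_coords c \<rho> = cot_coords c \<sigma>"
    have "chart_inv c (snd c (fst \<rho>)) = chart_inv c (snd c (fst \<sigma>))"
      using *(3) by (simp add: cot_coords_def)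
    then have "fst \<rho> = fst \<sigma>" using *(1,2) chart(5)[OF c] by simp
    then show "\<rho> = \<sigma>" using * c by (intro covector_unique[of c]) (auto simp: cot_coords_def)
  qed
  ultimately have "cot_inv A c (x, \<xi>) = \<rho>"
    unfolding cot_inv_def using inv_into_f_f[of "cot_coords c" ?S \<rho>] by simp
  then show "cot_inv A c (x, \<xi>) \<in> cotangent A" "fst (cot_inv A c (x, \<xi>)) = chart_inv c x"
    "snd (cot_inv A c (x, \<xi>)) c = \<xi>"
    using \<rho> by auto
qed

section \<open>Hamiltonians on the cotangent bundle and conservation of energy\<close>

text \<open>The chart-free counterpart of \<open>energy\<close>, so that the dual norm and
  \<open>q\<close> are treated together.\<close>

definition hamiltonian :: "('m \<Rightarrow> real) \<Rightarrow> real \<Rightarrow> ('m, 'n) covec \<Rightarrow> real" where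
  "hamiltonian V s \<rho> = sqrt ((conorm A G \<rho>)\<^sup>2 + s * V (fst \<rho>))"

lemma conorm_eq_hamiltonian: "conorm A G = hamiltonian V 0"
  unfolding hamiltonian_def using conorm_nonneg by (simp add: fun_eq_iff)

lemma q_ham_eq_hamiltonian: "q_ham A G V = hamiltonian V 1"
  unfolding hamiltonian_def q_ham_def by (simp add: fun_eq_iff)

lemma hamiltonian_chart:
  assumes "\<rho> \<in> cotangent A" "c \<in> A" "fst \<rho> \<in> fst c"
  shows "hamiltonian V s \<rho> = energy (gram c) (V \<circ> chart_inv c) s (cot_coords c \<rho>)"
  using assms chart(5)
  unfolding hamiltonian_def conorm_square[OF assms] energy_def cot_coords_def by simp

lemma hamiltonian_coords:
  assumes "c \<in> A" "fst z \<in> snd c ` fst c"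
  shows "(hamiltonian V s \<circ> cot_inv A c) z = energy (gram c) (V \<circ> chart_inv c) s z"
proof -
  obtain x \<xi> where z: "z = (x, \<xi>)" by (cases z)
  have x: "x \<in> snd c ` fst c" using assms z by simp
  show ?thesis
    using hamiltonian_chart[of "cot_inv A c z" c V s] cot_inv[OF assms(1) x, of \<xi>] chart(6,7)[OF assms(1) x]
    by (simp add: z assms cot_coords_def)
qed

context
  fixes V :: "'m \<Rightarrow> real"
  assumes V: "smooth_function A V"
begin

lemma V_smooth: "c \<in> A \<Longrightarrow> smooth_on (snd c ` fst c) (V \<circ> chart_inv c)"
  using V unfolding smooth_function_def by blast

lemma hamiltonian_derivative:
  assumes c: "c \<in> A" "fst z \<in> snd c ` fst c" and pos: "0 < energy (gram c) (V \<circ> chart_inv c) s z"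
  shows "((hamiltonian V s \<circ> cot_inv A c) has_derivative
    frechet_derivative (energy (gram c) (V \<circ> chart_inv c) s) (at z)) (at z)"
proof -
  have dg: "gram c differentiable (at (fst z))" and dV: "(V \<circ> chart_inv c) differentiable (at (fst z))"
    using smooth_onD(1)[OF gram_smooth[OF c(1)] c(2)] smooth_onD(1)[OF V_smooth[OF c(1)] c(2)] .
  have "(energy (gram c) (V \<circ> chart_inv c) s has_derivative
    frechet_derivative (energy (gram c) (V \<circ> chart_inv c) s) (at z)) (at z)"
    using has_derivative_energy[OF dg dV chart(2)[OF c(1)] c(2) gram_posdef'[OF c(1)] pos]
      frechet_derivative_works differentiableI by blast
  then show ?thesis
    by (rule has_derivative_transform_within_open[of _ _ _ _ "(snd c ` fst c) \<times> UNIV"])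
      (use c chart(2)[OF c(1)] hamiltonian_coords[OF c(1)] in \<open>auto intro: open_Times simp: mem_Times_iff\<close>)
qed

lemma ham_field_hamiltonian:
  assumes c: "c \<in> A" "fst z \<in> snd c ` fst c" and pos: "0 < energy (gram c) (V \<circ> chart_inv c) s z"
  shows "ham_field A (hamiltonian V s) c z = energy_field (gram c) (V \<circ> chart_inv c) s z"
proof -
  have dg: "gram c differentiable (at (fst z))" and dV: "(V \<circ> chart_inv c) differentiable (at (fst z))"
    using smooth_onD(1)[OF gram_smooth[OF c(1)] c(2)] smooth_onD(1)[OF V_smooth[OF c(1)] c(2)] .
  show ?thesis
    unfolding ham_field_def Let_def frechet_derivative_at[OF hamiltonian_derivative[OF assms], symmetric]
    by (rule energy_field_eq[OF dg dV chart(2)[OF c(1)] c(2) gram_posdef'[OF c(1)] pos])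
qed

text \<open>The derivative along the curve is the Poisson bracket of the Hamiltonian with itself, in
  which position and covector terms cancel. Positivity gives the differentiability of the
  Hamiltonian.\<close>

lemma hamiltonian_conserved:
  assumes \<gamma>: "ham_curve A \<Omega> (hamiltonian V s) \<gamma>" and \<Omega>: "\<Omega> \<subseteq> cotangent A"
    and pos: "\<And>\<rho>. \<rho> \<in> \<Omega> \<Longrightarrow> 0 < hamiltonian V s \<rho>"
  shows "hamiltonian V s (\<gamma> t) = hamiltonian V s (\<gamma> 0)"
proof -
  let ?H = "hamiltonian V s"
  have "((\<lambda>t. ?H (\<gamma> t)) has_vector_derivative 0) (at t)" for t
  proof -
    define c where "c = chart_at A (fst (\<gamma> t))"
    have c: "c \<in> A" "fst (\<gamma> t) \<in> fst c" using chart_at by (auto simp: c_def)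
    have in\<Omega>: "\<gamma> r \<in> \<Omega>" for r using \<gamma> unfolding ham_curve_def by auto
    then have cot: "\<gamma> r \<in> cotangent A" for r using \<Omega> by auto
    define z where "z = cot_coords c (\<gamma> t)"
    have z: "fst z \<in> snd c ` fst c" using c by (simp add: z_def cot_coords_def)
    have posz: "0 < energy (gram c) (V \<circ> chart_inv c) s z"
      using pos[OF in\<Omega>, of t] unfolding hamiltonian_chart[OF cot c] z_def .
    define D where "D = frechet_derivative (energy (gram c) (V \<circ> chart_inv c) s) (at z)"
    have HD: "((?H \<circ> cot_inv A c) has_derivative D) (at z)"
      unfolding D_def by (rule hamiltonian_derivative[OF c(1) z posz])
    have fD: "frechet_derivative (?H \<circ> cot_inv A c) (at z) = D"
      using frechet_derivative_at[OF HD] by simp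
    let ?X = "ham_field A ?H c z"
    have lin: "linear D" using HD by (rule has_derivative_linear)
    have "D ?X = D (fst ?X, 0) + D (0, snd ?X)"
      using linear_add[OF lin, of "(fst ?X, 0)" "(0, snd ?X)"] by simp
    also have "D (fst ?X, 0) = (\<Sum>j\<in>UNIV. fst ?X $ j * D (axis j 1, 0))"
    proof -
      have l: "linear (\<lambda>v. D (v, 0))"
        by (rule linearI; use linear_add[OF lin, of "(_, 0)" "(_, 0)"]
          linear_scale[OF lin, of _ "(_, 0)"] in simp)
      show ?thesis
        by (subst basis_expansion[symmetric, of "fst ?X"])
          (simp add: linear_sum[OF l] linear_scale[OF l] scalar_mult_eq_scaleR)
    qed
    also have "D (0, snd ?X) = (\<Sum>j\<in>UNIV. snd ?X $ j * D (0, axis j 1))"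
    proof -
      have l: "linear (\<lambda>v. D (0, v))"
        by (rule linearI; use linear_add[OF lin, of "(0, _)" "(0, _)"]
          linear_scale[OF lin, of _ "(0, _)"] in simp)
      show ?thesis
        by (subst basis_expansion[symmetric, of "snd ?X"])
          (simp add: linear_sum[OF l] linear_scale[OF l] scalar_mult_eq_scaleR)
    qed
    finally have DX: "D ?X = 0"
      by (simp add: ham_field_def Let_def fD sum_negf mult.commute)
    have g': "((cot_coords c \<circ> \<gamma>) has_vector_derivative ?X) (at t)"
      using \<gamma> c unfolding ham_curve_def z_def by auto
    have "((?H \<circ> cot_inv A c) \<circ> (cot_coords c \<circ> \<gamma>) has_derivative D \<circ> (\<lambda>h. h *\<^sub>R ?X)) (at t)"
      by (rule diff_chain_at) (use g' HD in \<open>auto simp: has_vector_derivative_def z_def\<close>)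
    then have "((?H \<circ> cot_inv A c) \<circ> (cot_coords c \<circ> \<gamma>) has_vector_derivative 0) (at t)"
      by (simp add: has_vector_derivative_def o_def linear_scale[OF lin] DX)
    then show ?thesis
    proof (rule has_vector_derivative_transform_within_open)
      \<comment> \<open>The coordinates represent the Hamiltonian only while the curve is over
        \<open>c\<close>; continuity of the base point makes the set of these times open.\<close>
      have "continuous_on UNIV (fst \<circ> \<gamma>)" using \<gamma> unfolding ham_curve_def by blast
      then show "open ((fst \<circ> \<gamma>) -` fst c)"
        using chart(1)[OF c(1)] open_vimage by blast
      show "t \<in> (fst \<circ> \<gamma>) -` fst c" using c by simp
      fix r assume "r \<in> (fst \<circ> \<gamma>) -` fst c"
      then have r: "fst (\<gamma> r) \<in> fst c" by simp
      then have "fst (cot_coords c (\<gamma> r)) \<in> snd c ` fst c" by (simp add: cot_coords_def)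
      then show "((?H \<circ> cot_inv A c) \<circ> (cot_coords c \<circ> \<gamma>)) r = ?H (\<gamma> r)"
        using hamiltonian_coords[OF c(1)] hamiltonian_chart[OF cot c(1) r] by simp
    qed
  qed
  then show ?thesis
    using has_derivative_zero_unique[of UNIV "\<lambda>t. ?H (\<gamma> t)" 0 t]
    by (auto simp: has_vector_derivative_def)
qed

end

section \<open>Riemannian distance inside a chart\<close>

text \<open>The infimum of real lengths needs a lower bound: lengths are nonnegative, and a speed
  that is not integrable has integral 0 by convention.\<close>

lemma riem_dist_le:
  assumes "piecewise_C1_curve A \<gamma>" "\<gamma> 0 = a" "\<gamma> 1 = b"
  shows "riem_dist A G a b \<le> integral {0..1} (speed A G \<gamma>)"
  unfolding riem_dist_def
proof (rule cInf_lower)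
  show "bdd_below {integral {0..1} (speed A G \<gamma>) |\<gamma>. piecewise_C1_curve A \<gamma> \<and> \<gamma> 0 = a \<and> \<gamma> 1 = b}"
  proof (rule bdd_belowI[of _ 0], clarify)
    fix \<gamma>
    have "0 \<le> speed A G \<gamma> t" for t
    proof -
      have "0 \<le> v \<bullet> (G (chart_at A (\<gamma> t)) (\<gamma> t) *v v)" for v
        using gram_posdef[OF chart_at] unfolding posdef_def
        by (metis inner_zero_left less_eq_real_def)
      then show ?thesis unfolding speed_def Let_def by simp
    qed
    then show "0 \<le> integral {0..1} (speed A G \<gamma>)"
      by (cases "speed A G \<gamma> integrable_on {0..1}") (auto intro: integral_nonneg simp: not_integrable_integral)
  qed
qed (use assms in blast)

text \<open>Coordinate segments in a small ball are short, because the metric is at most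
  \<open>K\<close> times the Euclidean one there. This links the topology in which limits are taken
  with the distance that defines the neighbourhood of \<open>\<omega>\<close>.\<close>

lemma locally_riem_dist_small:
  assumes \<delta>: "0 < \<delta>"
  shows "\<exists>N. open N \<and> p \<in> N \<and> (\<forall>a\<in>N. \<forall>b\<in>N. riem_dist A G a b < \<delta>)"
proof -
  define c where "c = chart_at A p"
  have c: "c \<in> A" "p \<in> fst c" using chart_at by (auto simp: c_def)
  define x0 where "x0 = snd c p"
  let ?U = "snd c ` fst c"
  have x0: "x0 \<in> ?U" using c by (simp add: x0_def)
  define K where "K = entry_bound (gram c x0) + 1"
  have K: "0 < K" using entry_bound_ge_1[of "gram c x0"] by (simp add: K_def)
  obtain r0 where r0: "r0 > 0" "ball x0 r0 \<subseteq> ?U"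
    using x0 chart(2)[OF c(1)] openE by blast
  have "isCont (gram c) x0"
    using smooth_onD(3)[OF gram_smooth[OF c(1)]] x0 chart(2)[OF c(1)] continuous_on_eq_continuous_at by blast
  then have "isCont (\<lambda>x. entry_bound (gram c x)) x0" by (rule isCont_entry_bound)
  then obtain r1 where r1: "r1 > 0" "\<And>x. dist x x0 < r1 \<Longrightarrow> dist (entry_bound (gram c x)) (entry_bound (gram c x0)) < 1"
    unfolding continuous_at_eps_delta by (metis zero_less_one)
  \<comment> \<open>The first two bounds keep the ball in the chart and the metric below
    \<open>K\<close>. The third makes segments of Euclidean length at most \<open>2 * r\<close> no
    longer than \<open>\<delta> / 2\<close>.\<close>
  define r where "r = min (min r0 r1) (\<delta> / (4 * sqrt K))"
  have r: "r > 0" using r0 r1 \<delta> K by (simp add: r_def)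
  have rU: "ball x0 r \<subseteq> ?U" using r0 by (auto simp: r_def)
  have bound: "v \<bullet> (gram c x *v v) \<le> K * (norm v)\<^sup>2" if "x \<in> ball x0 r" for x v
  proof -
    have "entry_bound (gram c x) \<le> K"
      using r1(2)[of x] that by (auto simp: r_def K_def dist_commute dist_real_def)
    then show ?thesis
      using quadratic_form_le[of v "gram c x"] by (meson mult_right_mono order_trans zero_le_power2)
  qed
  define N where "N = fst c \<inter> snd c -` ball x0 r"
  have N: "open N" "p \<in> N"
    using open_chart_preimage[OF c(1)] c r by (auto simp: N_def x0_def)
  have "riem_dist A G a b < \<delta>" if ab: "a \<in> N" "b \<in> N" for a b
  proof -
    define v where "v = snd c b - snd c a"
    define l where "l s = snd c a + s *\<^sub>R v" for s :: real
    define \<gamma> where "\<gamma> = chart_inv c \<circ> l"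
    have ends: "\<gamma> 0 = a" "\<gamma> 1 = b"
      using ab chart(5)[OF c(1)] by (auto simp: \<gamma>_def l_def v_def N_def)
    have l_in: "l s \<in> ball x0 r" if "s \<in> {0..1}" for s
    proof -
      have "l s = (1 - s) *\<^sub>R snd c a + s *\<^sub>R snd c b"
        by (simp add: l_def v_def algebra_simps)
      then show ?thesis
        using convex_ball[of x0 r] ab that unfolding convex_alt N_def by force
    qed
    have lU: "l s \<in> ?U" if "s \<in> {0..1}" for s using l_in[OF that] rU by blast
    have lc: "continuous_on S l" for S unfolding l_def by (intro continuous_intros)
    have ld: "(l has_vector_derivative v) (at s)" for s
      unfolding l_def has_vector_derivative_def by (auto intro!: derivative_eq_intros)
    have \<gamma>c: "\<gamma> s \<in> fst c" "snd c (\<gamma> s) = l s" if "s \<in> {0..1}" for s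
      using chart(6,7)[OF c(1) lU[OF that]] by (auto simp: \<gamma>_def)
    \<comment> \<open>The curve is a segment in \<open>c\<close>, but being a
      \<open>C1_curve_on\<close> concerns every chart \<open>d\<close>, where its velocity is the
      image under the Jacobian.\<close>
    have der: "((snd d \<circ> \<gamma>) has_vector_derivative jac c d (\<gamma> s) *v v) (at s)"
      if d: "d \<in> A" "\<gamma> s \<in> fst d" and s: "s \<in> {0..1}" for d s
    proof -
      have "((snd d \<circ> chart_inv c) has_derivative (*v) (jac c d (\<gamma> s))) (at (l s))"
        using transition_derivative[OF c(1) d(1) \<gamma>c(1)[OF s] d(2)] \<gamma>c(2)[OF s] by simp
      from diff_chain_at[OF ld[of s, unfolded has_vector_derivative_def] this]
      show ?thesis
        unfolding has_vector_derivative_def \<gamma>_def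
        by (simp add: o_def matrix_vector_mult_scaleR)
    qed
    have "C1_curve_on A \<gamma> 0 1"
      unfolding C1_curve_on_def Let_def
    proof (intro conjI ballI)
      show \<gamma>cont: "continuous_on {0..1} \<gamma>"
        unfolding \<gamma>_def by (rule continuous_on_compose[OF lc continuous_on_subset[OF chart(4)[OF c(1)]]]) (use lU in auto)
      fix d assume d: "d \<in> A"
      let ?S = "{t \<in> {0..1}. \<gamma> t \<in> fst d}"
      have "continuous_on ?S (\<lambda>t. jac c d (\<gamma> t) *v v)"
        unfolding continuous_on_def
      proof
        fix t assume t: "t \<in> ?S"
        have "(\<gamma> \<longlongrightarrow> \<gamma> t) (at t within ?S)"
          using continuous_on_subset[OF \<gamma>cont, of ?S] t unfolding continuous_on_def by blast
        then have "((\<lambda>s. jac c d (\<gamma> s)) \<longlongrightarrow> jac c d (\<gamma> t)) (at t within ?S)"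
          by (intro tendsto_jac) (use c d t \<gamma>c in auto)
        then show "((\<lambda>s. jac c d (\<gamma> s) *v v) \<longlongrightarrow> jac c d (\<gamma> t) *v v) (at t within ?S)"
          by (rule bounded_linear.tendsto[OF bounded_linear_matrix_vector_left])
      qed
      moreover have "\<forall>t\<in>?S. ((snd d \<circ> \<gamma>) has_vector_derivative jac c d (\<gamma> t) *v v) (at t within ?S)"
        using der d has_vector_derivative_at_within by blast
      ultimately show "\<exists>D. continuous_on ?S D \<and>
          (\<forall>t\<in>?S. ((snd d \<circ> \<gamma>) has_vector_derivative D t) (at t within ?S))"
        by blast
    qed
    then have pw: "piecewise_C1_curve A \<gamma>"
      unfolding piecewise_C1_curve_def by (intro exI[of _ "{0, 1}"]) auto
    \<comment> \<open>\<open>speed\<close> uses a chart that may change with \<open>s\<close>;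
      invariance of the metric allows the fixed chart \<open>c\<close> instead.\<close>
    have sp: "speed A G \<gamma> s = sqrt (v \<bullet> (gram c (l s) *v v))" if s: "s \<in> {0..1}" for s
    proof -
      define d where "d = chart_at A (\<gamma> s)"
      have d: "d \<in> A" "\<gamma> s \<in> fst d" using chart_at by (auto simp: d_def)
      define J where "J = jac c d (\<gamma> s)"
      have "vector_derivative (snd d \<circ> \<gamma>) (at s) = J *v v"
        unfolding J_def by (rule vector_derivative_at[OF der[OF d s]])
      moreover have "v \<bullet> (G c (\<gamma> s) *v v) = (J *v v) \<bullet> (G d (\<gamma> s) *v (J *v v))"
        unfolding gram_change[OF c(1) d(1) \<gamma>c(1)[OF s] d(2)] J_def[symmetric]
        by (simp add: matrix_vector_mul_assoc[symmetric] inner_transpose del: transpose_matrix_vector)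
      moreover have "gram c (l s) = G c (\<gamma> s)" by (simp add: \<gamma>_def)
      ultimately show ?thesis
        unfolding speed_def Let_def d_def[symmetric] by simp
    qed
    have "l ` {0..1} \<subseteq> ?U" using lU by blast
    from continuous_on_compose[OF lc continuous_on_subset[OF smooth_onD(3)[OF gram_smooth[OF c(1)]] this]]
    have "continuous_on {0..1} (\<lambda>s. gram c (l s))" by (simp add: o_def)
    then have "continuous_on {0..1} (\<lambda>s. gram c (l s) *v v)"
      by (rule bounded_linear.continuous_on[OF bounded_linear_matrix_vector_left])
    then have cont: "continuous_on {0..1} (\<lambda>s. sqrt (v \<bullet> (gram c (l s) *v v)))"
      by (intro continuous_intros)
    have "riem_dist A G a b \<le> integral {0..1} (speed A G \<gamma>)"
      by (rule riem_dist_le[OF pw ends])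
    also have "\<dots> = integral {0..1} (\<lambda>s. sqrt (v \<bullet> (gram c (l s) *v v)))"
      by (rule integral_cong) (rule sp)
    also have "\<dots> \<le> norm (integral {0..1} (\<lambda>s. sqrt (v \<bullet> (gram c (l s) *v v))))" by simp
    also have "\<dots> \<le> (sqrt K * norm v) * (1 - 0)"
    proof (rule integral_bound[OF _ cont])
      fix s :: real assume s: "s \<in> {0..1}"
      have "0 \<le> v \<bullet> (gram c (l s) *v v)"
        using gram_posdef'[OF c(1) lU[OF s]] unfolding posdef_def
        by (metis inner_zero_left less_eq_real_def)
      then have "norm (sqrt (v \<bullet> (gram c (l s) *v v))) = sqrt (v \<bullet> (gram c (l s) *v v))" by simp
      also have "\<dots> \<le> sqrt (K * (norm v)\<^sup>2)" using bound[OF l_in[OF s]] by simp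
      also have "\<dots> = sqrt K * norm v" by (simp add: real_sqrt_mult)
      finally show "norm (sqrt (v \<bullet> (gram c (l s) *v v))) \<le> sqrt K * norm v" .
    qed simp
    also have "\<dots> \<le> sqrt K * (2 * r)"
    proof -
      have "dist (snd c b) (snd c a) \<le> dist x0 (snd c b) + dist x0 (snd c a)"
        by (rule dist_triangle3)
      then have "norm v \<le> 2 * r" using ab by (auto simp: v_def N_def dist_norm)
      then show ?thesis using K by (simp add: mult_left_mono)
    qed
    also have "\<dots> \<le> sqrt K * (2 * (\<delta> / (4 * sqrt K)))"
      using K by (intro mult_left_mono) (auto simp: r_def)
    also have "\<dots> < \<delta>" using K \<delta> by simp
    finally show ?thesis .
  qed
  then show ?thesis using N by blast
qed

end

section \<open>The high-frequency limit\<close>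

locale high_frequency_curves = riemannian_atlas A G
  for A :: "('m::t2_space, 'n::finite) chart set"
    and G :: "('m, 'n) chart \<Rightarrow> 'm \<Rightarrow> real^'n^'n" +
  fixes V :: "'m \<Rightarrow> real" and h :: "nat \<Rightarrow> real" and F :: "nat filter"
    and \<rho> :: "('m, 'n) covec" and \<gamma> :: "nat \<Rightarrow> real \<Rightarrow> ('m, 'n) covec"
  assumes compact_space: "compact (UNIV :: 'm set)"
    and V_smooth_function: "smooth_function A V" and V_pos: "0 < V p"
    and F: "ultra F" and h_lim: "(h \<longlongrightarrow> 0) F" and h_pos: "0 < h n"
    and \<rho>: "\<rho> \<in> cosphere A G"
    and curve: "ham_curve A (cotangent A) (q_ham A G V) (\<gamma> n)"
    and start: "\<gamma> n 0 = (fst \<rho>, \<lambda>c. snd \<rho> c /\<^sub>R h n)"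
begin

text \<open>The rescaled curve: \<open>\<gamma> n\<close> solves the equation of \<open>q\<close>
  from a large covector, and multiplying by \<open>h n\<close> brings the covector back to unit
  size.\<close>

definition coords :: "('m, 'n) chart \<Rightarrow> nat \<Rightarrow> real \<Rightarrow> (real^'n) \<times> (real^'n)" where
  "coords c n t = (snd c (fst (\<gamma> n t)), h n *\<^sub>R snd (\<gamma> n t) c)"

definition limit_point :: "real \<Rightarrow> 'm" where
  "limit_point t = (SOME p. ((\<lambda>n. fst (\<gamma> n t)) \<longlongrightarrow> p) F)"

text \<open>Limits are chosen separately in each chart; their compatibility is proved in
  \<open>limit_curve_cotangent\<close>. The value 0 elsewhere is the one that
  \<open>cotangent\<close> prescribes.\<close>

definition limit_covector :: "real \<Rightarrow> ('m, 'n) chart \<Rightarrow> real^'n" where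
  "limit_covector t c = (if c \<in> A \<and> limit_point t \<in> fst c
     then SOME \<xi>. ((\<lambda>n. h n *\<^sub>R snd (\<gamma> n t) c) \<longlongrightarrow> \<xi>) F else 0)"

definition limit_curve :: "real \<Rightarrow> ('m, 'n) covec" where
  "limit_curve t = (limit_point t, limit_covector t)"

abbreviation field :: "('m, 'n) chart \<Rightarrow> real \<Rightarrow> (real^'n) \<times> (real^'n) \<Rightarrow> (real^'n) \<times> (real^'n)" where
  "field c \<equiv> energy_field (gram c) (V \<circ> chart_inv c)"

lemma F_nonbot: "F \<noteq> bot"
  using F unfolding ultra_def by blast

lemma \<rho>_cotangent: "\<rho> \<in> cotangent A" and \<rho>_conorm: "conorm A G \<rho> = 1"
  using \<rho> unfolding cosphere_def by auto

lemma curve_cotangent: "\<gamma> n t \<in> cotangent A"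
  using curve[of n] unfolding ham_curve_def by auto

lemma hamiltonian_pos: "0 < hamiltonian V 1 \<sigma>"
  unfolding hamiltonian_def using V_pos[of "fst \<sigma>"] by (simp add: add_nonneg_pos)

lemma tendsto_limit_point: "((\<lambda>n. fst (\<gamma> n t)) \<longlongrightarrow> limit_point t) F"
  unfolding limit_point_def
  by (rule someI_ex) (use ultra_compact_limit[OF F compact_space] in auto)

lemma eventually_in_chart:
  "c \<in> A \<Longrightarrow> limit_point t \<in> fst c \<Longrightarrow> eventually (\<lambda>n. fst (\<gamma> n t) \<in> fst c) F"
  using tendsto_limit_point chart(1) topological_tendstoD by blast

lemma tendsto_base_coords:
  assumes "c \<in> A" "limit_point t \<in> fst c"
  shows "((\<lambda>n. snd c (fst (\<gamma> n t))) \<longlongrightarrow> snd c (limit_point t)) F"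
  using continuous_on_tendsto_compose[OF chart(3)[OF assms(1)] tendsto_limit_point assms(2)]
    eventually_in_chart[OF assms] by blast

text \<open>The energy of \<open>q\<close> is conserved and scales with \<open>h n\<close>, so its
  value can be read off at time 0, where the rescaled covector is \<open>\<rho>\<close>
  itself.\<close>

lemma energy_coords:
  assumes c: "c \<in> A" "fst (\<gamma> n t) \<in> fst c"
  shows "energy (gram c) (V \<circ> chart_inv c) ((h n)\<^sup>2) (coords c n t) = sqrt (1 + (h n)\<^sup>2 * V (fst \<rho>))"
proof -
  have h: "h n \<noteq> 0" using h_pos[of n] by simp
  \<comment> \<open>Chart and time are kept general, since the starting point may lie outside
    \<open>c\<close>.\<close>
  have scale: "energy (gram d) (V \<circ> chart_inv d) ((h n)\<^sup>2) (coords d n s)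
      = h n * hamiltonian V 1 (\<gamma> n s)" if "d \<in> A" "fst (\<gamma> n s) \<in> fst d" for d s
    using hamiltonian_chart[OF curve_cotangent that, of V 1] h
    unfolding coords_def energy_scale[OF h_pos] by (simp add: cot_coords_def)
  define d where "d = chart_at A (fst \<rho>)"
  have d: "d \<in> A" "fst \<rho> \<in> fst d" using chart_at by (auto simp: d_def)
  have "hamiltonian V 1 (\<gamma> n t) = hamiltonian V 1 (\<gamma> n 0)"
    by (rule hamiltonian_conserved[OF V_smooth_function curve[of n, unfolded q_ham_eq_hamiltonian]
      order_refl hamiltonian_pos])
  then have "energy (gram c) (V \<circ> chart_inv c) ((h n)\<^sup>2) (coords c n t) = h n * hamiltonian V 1 (\<gamma> n 0)"
    using scale[OF c] by simp
  also have "\<dots> = energy (gram d) (V \<circ> chart_inv d) ((h n)\<^sup>2) (coords d n 0)"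
    using scale[of d 0] d start by simp
  also have "coords d n 0 = cot_coords d \<rho>"
    using h by (simp add: coords_def start cot_coords_def)
  also have "energy (gram d) (V \<circ> chart_inv d) ((h n)\<^sup>2) (cot_coords d \<rho>) = hamiltonian V ((h n)\<^sup>2) \<rho>"
    using hamiltonian_chart[OF \<rho>_cotangent d] by simp
  finally show ?thesis by (simp only: hamiltonian_def \<rho>_conorm power_one)
qed

text \<open>Conserved energy bounds the inverse form. Near the limit point the metric is bounded, so
  the covectors eventually lie in a fixed compact ball.\<close>

lemma tendsto_limit_covector:
  assumes c: "c \<in> A" "limit_point t \<in> fst c"
  shows "((\<lambda>n. h n *\<^sub>R snd (\<gamma> n t) c) \<longlongrightarrow> limit_covector t c) F"
proof -
  let ?x = "\<lambda>n. snd c (fst (\<gamma> n t))" and ?\<xi> = "\<lambda>n. h n *\<^sub>R snd (\<gamma> n t) c"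
  \<comment> \<open>The added 1 leaves room for the base points, which have only converged
    approximately.\<close>
  define K where "K = entry_bound (gram c (snd c (limit_point t))) + 1"
  have "isCont (gram c) (snd c (limit_point t))"
    using smooth_onD(3)[OF gram_smooth[OF c(1)]] c chart(2)[OF c(1)] continuous_on_eq_continuous_at by blast
  then have "isCont (\<lambda>x. entry_bound (gram c x)) (snd c (limit_point t))" by (rule isCont_entry_bound)
  then have "((\<lambda>n. entry_bound (gram c (?x n))) \<longlongrightarrow> entry_bound (gram c (snd c (limit_point t)))) F"
    by (rule isCont_tendsto_compose) (rule tendsto_base_coords[OF c])
  then have 1: "eventually (\<lambda>n. entry_bound (gram c (?x n)) < K) F"
    by (rule order_tendstoD) (simp add: K_def)
  have 2: "eventually (\<lambda>n. h n < 1) F"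
    using h_lim by (rule order_tendstoD) simp
  have "eventually (\<lambda>n. ?\<xi> n \<in> cball 0 (sqrt (K * (1 + V (fst \<rho>))))) F"
    using 1 2 eventually_in_chart[OF c]
  proof eventually_elim
    case (elim n)
    have p: "posdef (gram c (?x n))" using gram_posdef'[OF c(1)] elim(3) by blast
    define W where "W = ?\<xi> n \<bullet> (matrix_inv (gram c (?x n)) *v ?\<xi> n)"
    have W: "0 \<le> W" unfolding W_def by (rule posdef_inverse_form[OF p])
    have hV: "0 \<le> (h n)\<^sup>2 * V q" for q using V_pos[of q] by simp
    have "sqrt (W + (h n)\<^sup>2 * V (fst (\<gamma> n t))) = sqrt (1 + (h n)\<^sup>2 * V (fst \<rho>))"
      using energy_coords[OF c(1) elim(3)] chart(5)[OF c(1) elim(3)]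
      by (simp add: energy_def coords_def W_def)
    then have "W + (h n)\<^sup>2 * V (fst (\<gamma> n t)) = 1 + (h n)\<^sup>2 * V (fst \<rho>)" by simp
    then have "W \<le> 1 + (h n)\<^sup>2 * V (fst \<rho>)" using hV by (metis le_add_same_cancel1)
    also have "\<dots> \<le> 1 + 1 * V (fst \<rho>)"
      using V_pos[of "fst \<rho>"] h_pos[of n] elim(2)
      by (intro add_left_mono mult_right_mono power_le_one) auto
    finally have "W \<le> 1 + V (fst \<rho>)" by simp
    have "(norm (?\<xi> n))\<^sup>2 \<le> entry_bound (gram c (?x n)) * W"
      unfolding W_def by (rule norm_le_inverse_form[OF p])
    also have "\<dots> \<le> K * (1 + V (fst \<rho>))"
      using elim(1) \<open>W \<le> 1 + V (fst \<rho>)\<close> W entry_bound_ge_1[of "gram c (?x n)"] by (intro mult_mono) auto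
    finally show ?case by (simp add: real_le_rsqrt)
  qed
  from ultra_compact_limit[OF F compact_cball this]
  have "\<exists>\<xi>. (?\<xi> \<longlongrightarrow> \<xi>) F" by blast
  then have "(?\<xi> \<longlongrightarrow> (SOME \<xi>. (?\<xi> \<longlongrightarrow> \<xi>) F)) F" by (rule someI_ex)
  then show ?thesis unfolding limit_covector_def using c by simp
qed

lemma tendsto_coords:
  assumes c: "c \<in> A" "limit_point t \<in> fst c"
  shows "((\<lambda>n. coords c n t) \<longlongrightarrow> cot_coords c (limit_curve t)) F"
  unfolding coords_def cot_coords_def limit_curve_def fst_conv snd_conv
  by (intro tendsto_Pair tendsto_base_coords tendsto_limit_covector c)

text \<open>The transformation law holds for each \<open>n\<close> and passes to the limit because
  the Jacobians are continuous.\<close>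

lemma limit_curve_cotangent: "limit_curve t \<in> cotangent A"
  unfolding limit_curve_def cotangent_def case_prod_conv mem_Collect_eq
proof (intro conjI ballI allI impI)
  fix c d assume cd: "c \<in> A" "d \<in> A" "limit_point t \<in> fst c \<and> limit_point t \<in> fst d"
  let ?y = "\<lambda>n. fst (\<gamma> n t)" and ?\<xi> = "\<lambda>c n. h n *\<^sub>R snd (\<gamma> n t) c"
  have T: "((\<lambda>n. transpose (jac c d (?y n))) \<longlongrightarrow> transpose (jac c d (limit_point t))) F"
    unfolding transpose_def
    by (intro tendsto_vec_lambda tendsto_vec_nth tendsto_jac tendsto_limit_point) (use cd in auto)
  have "((\<lambda>n. transpose (jac c d (?y n)) *v ?\<xi> d n)
      \<longlongrightarrow> transpose (jac c d (limit_point t)) *v limit_covector t d) F"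
    unfolding matrix_vector_mult_def
    by (intro tendsto_vec_lambda tendsto_sum tendsto_mult tendsto_vec_nth T tendsto_limit_covector) (use cd in auto)
  moreover have "eventually (\<lambda>n. transpose (jac c d (?y n)) *v ?\<xi> d n = ?\<xi> c n) F"
    using eventually_in_chart[OF cd(1)] eventually_in_chart[OF cd(2)]
  proof (rule eventually_elim2)
    fix n assume "?y n \<in> fst c" "?y n \<in> fst d"
    from cotangentD(1)[OF curve_cotangent cd(1,2) this]
    show "transpose (jac c d (?y n)) *v ?\<xi> d n = ?\<xi> c n"
      by (simp only: matrix_vector_mult_scaleR)
  qed (use cd in auto)
  ultimately have "(?\<xi> c \<longlongrightarrow> transpose (jac c d (limit_point t)) *v limit_covector t d) F"
    by (rule Lim_transform_eventually)
  then show "limit_covector t c = transpose (jac c d (limit_point t)) *v limit_covector t d"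
    using tendsto_unique[OF F_nonbot tendsto_limit_covector[OF cd(1)]] cd(3) by blast
next
  fix c assume "\<not> (c \<in> A \<and> limit_point t \<in> fst c)"
  then show "limit_covector t c = 0" unfolding limit_covector_def by (rule if_not_P)
qed

text \<open>Joint continuity at \<open>s = 0\<close> takes the conserved value to its limit 1. The
  limit thus avoids the zero section, where the dual norm is not smooth.\<close>

lemma energy_limit_curve:
  assumes c: "c \<in> A" "limit_point t \<in> fst c"
  shows "energy (gram c) (V \<circ> chart_inv c) 0 (cot_coords c (limit_curve t)) = 1"
proof -
  let ?z = "cot_coords c (limit_curve t)"
  have z: "fst ?z \<in> snd c ` fst c" using c by (simp add: cot_coords_def limit_curve_def)
  have "isCont (\<lambda>p. energy (gram c) (V \<circ> chart_inv c) (fst p) (snd p)) (0, ?z)"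
    by (rule isCont_energy[OF smooth_onD(3)[OF gram_smooth[OF c(1)]]
          smooth_onD(3)[OF V_smooth[OF V_smooth_function c(1)]] chart(2)[OF c(1)] z
          posdef_invertible[OF gram_posdef'[OF c(1) z]]])
  moreover have "((\<lambda>n. ((h n)\<^sup>2, coords c n t)) \<longlongrightarrow> (0, ?z)) F"
    using tendsto_power[OF h_lim, of 2] by (intro tendsto_Pair tendsto_coords c) simp
  ultimately have "((\<lambda>n. energy (gram c) (V \<circ> chart_inv c) ((h n)\<^sup>2) (coords c n t))
      \<longlongrightarrow> energy (gram c) (V \<circ> chart_inv c) 0 ?z) F"
    using isCont_tendsto_compose by fastforce
  moreover have "eventually (\<lambda>n. energy (gram c) (V \<circ> chart_inv c) ((h n)\<^sup>2) (coords c n t)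
      = sqrt (1 + (h n)\<^sup>2 * V (fst \<rho>))) F"
    using eventually_in_chart[OF c] by eventually_elim (rule energy_coords[OF c(1)])
  ultimately have "((\<lambda>n. sqrt (1 + (h n)\<^sup>2 * V (fst \<rho>)))
      \<longlongrightarrow> energy (gram c) (V \<circ> chart_inv c) 0 ?z) F"
    by (rule Lim_transform_eventually)
  moreover have "((\<lambda>n. sqrt (1 + (h n)\<^sup>2 * V (fst \<rho>))) \<longlongrightarrow> sqrt (1 + 0\<^sup>2 * V (fst \<rho>))) F"
    by (intro tendsto_intros h_lim)
  ultimately show ?thesis
    using tendsto_unique[OF F_nonbot] by fastforce
qed

lemma conorm_limit_curve: "conorm A G (limit_curve t) = 1"
proof -
  let ?c = "chart_at A (limit_point t)"
  have c: "?c \<in> A" "limit_point t \<in> fst ?c" using chart_at by auto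
  then show ?thesis
    using hamiltonian_chart[OF limit_curve_cotangent c(1), of t V 0] energy_limit_curve[OF c]
    by (simp add: limit_curve_def conorm_eq_hamiltonian[of V])
qed

lemma limit_curve_start: "limit_curve 0 = \<rho>"
proof -
  have base: "limit_point 0 = fst \<rho>"
    using tendsto_unique[OF F_nonbot tendsto_limit_point[of 0]] by (simp add: start tendsto_const)
  define c where "c = chart_at A (fst \<rho>)"
  have c: "c \<in> A" "fst \<rho> \<in> fst c" using chart_at by (auto simp: c_def)
  have "h n *\<^sub>R snd (\<gamma> n 0) c = snd \<rho> c" for n
    using h_pos[of n] by (simp add: start)
  then have "limit_covector 0 c = snd \<rho> c"
    using tendsto_unique[OF F_nonbot tendsto_limit_covector[OF c(1), of 0]] c base
    by (simp add: tendsto_const)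
  then show ?thesis
    using covector_unique[OF c(1) limit_curve_cotangent \<rho>_cotangent, of 0] c base
    by (simp add: limit_curve_def)
qed

section \<open>Passage to the limit in the equation of motion\<close>

text \<open>The linear map that multiplies covectors by \<open>h n\<close> is applied to the
  equation of \<open>q\<close>.\<close>

lemma coords_derivative:
  assumes c: "c \<in> A" "fst (\<gamma> n t) \<in> fst c"
  shows "(coords c n has_vector_derivative field c ((h n)\<^sup>2) (coords c n t)) (at t)"
proof -
  let ?z = "cot_coords c (\<gamma> n t)"
  let ?S = "\<lambda>z :: (real^'n) \<times> (real^'n). (fst z, h n *\<^sub>R snd z)"
  have "0 < energy (gram c) (V \<circ> chart_inv c) 1 ?z"
    using hamiltonian_pos[of "\<gamma> n t"] unfolding hamiltonian_chart[OF curve_cotangent c] .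
  then have f: "ham_field A (q_ham A G V) c ?z = field c 1 ?z"
    unfolding q_ham_eq_hamiltonian
    by (intro ham_field_hamiltonian[OF V_smooth_function c(1)]) (use c in \<open>simp_all add: cot_coords_def\<close>)
  have "((cot_coords c \<circ> \<gamma> n) has_vector_derivative field c 1 ?z) (at t)"
    using curve[of n] c unfolding ham_curve_def f[symmetric] by blast
  moreover have "bounded_linear ?S"
    by (intro bounded_linear_Pair bounded_linear_fst bounded_linear_scaleR_right[THEN bounded_linear_compose] bounded_linear_snd)
  ultimately have "((\<lambda>t. ?S ((cot_coords c \<circ> \<gamma> n) t)) has_vector_derivative ?S (field c 1 ?z)) (at t)"
    by (rule bounded_linear.has_vector_derivative[rotated])
  moreover have "(\<lambda>t. ?S ((cot_coords c \<circ> \<gamma> n) t)) = coords c n"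
    by (simp add: fun_eq_iff coords_def cot_coords_def)
  moreover have "?S (field c 1 ?z) = field c ((h n)\<^sup>2) (coords c n t)"
    using h_pos[of n] unfolding coords_def energy_field_scale[OF h_pos]
    by (simp add: cot_coords_def)
  ultimately show ?thesis by simp
qed

text \<open>The uniformity behind the limit: \<open>\<tau>\<close> and \<open>K\<close> are fixed
  before \<open>n\<close>. All rescaled fields are within \<open>e\<close> of \<open>w\<close> near
  the limit state, and the curves cannot leave that region within time
  \<open>\<tau>\<close>.\<close>

lemma coords_linearization:
  assumes c: "c \<in> A" "limit_point t \<in> fst c" and e: "0 < e"
  defines "w \<equiv> field c 0 (cot_coords c (limit_curve t))"
  shows "\<exists>\<tau>>0. \<exists>K. compact K \<and> K \<subseteq> fst c \<and> eventually (\<lambda>n. \<forall>r. \<bar>r - t\<bar> \<le> \<tau> \<longrightarrow>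
    fst (\<gamma> n r) \<in> K \<and> norm (coords c n r - coords c n t - (r - t) *\<^sub>R w) \<le> e * \<bar>r - t\<bar>) F"
proof -
  let ?U = "snd c ` fst c"
  define z0 where "z0 = cot_coords c (limit_curve t)"
  have z0: "fst z0 \<in> ?U" using c by (simp add: z0_def cot_coords_def limit_curve_def)
  have "isCont (\<lambda>p. field c (fst p) (snd p)) (0, z0)"
    by (rule isCont_energy_field[OF gram_smooth[OF c(1)] V_smooth[OF V_smooth_function c(1)]
          chart(2)[OF c(1)] z0 posdef_invertible[OF gram_posdef'[OF c(1) z0]]])
      (simp only: z0_def energy_limit_curve[OF c] zero_less_one)
  then obtain \<eta>0 where \<eta>0: "\<eta>0 > 0"
    "\<And>p. dist p (0, z0) < \<eta>0 \<Longrightarrow> dist (field c (fst p) (snd p)) w < e"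
    unfolding continuous_at_eps_delta w_def z0_def[symmetric] using e by fastforce
  obtain r0 where r0: "r0 > 0" "ball (fst z0) r0 \<subseteq> ?U"
    using z0 chart(2)[OF c(1)] openE by blast
  \<comment> \<open>Half of \<open>\<eta>0\<close> is for the state and the other half for the
    parameter \<open>(h n)\<^sup>2\<close>; \<open>r0\<close> keeps the ball in the chart.\<close>
  define \<eta> where "\<eta> = min (\<eta>0 / 2) r0"
  have \<eta>: "0 < \<eta>" using \<eta>0 r0 by (simp add: \<eta>_def)
  define K where "K = chart_inv c ` cball (fst z0) (3 * \<eta> / 4)"
  have sub: "cball (fst z0) (3 * \<eta> / 4) \<subseteq> ?U"
    using r0 \<eta> by (auto simp: \<eta>_def subset_iff)
  have K: "compact K" "K \<subseteq> fst c"
    unfolding K_def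
    using compact_continuous_image[OF continuous_on_subset[OF chart(4)[OF c(1)] sub] compact_cball]
      sub chart(7)[OF c(1)] by blast+
  \<comment> \<open>At speed at most \<open>norm w + e\<close>, the distance covered in time
    \<open>\<tau>\<close> is at most \<open>\<eta> / 4\<close>, as the trapping lemma
    requires.\<close>
  define \<tau> where "\<tau> = \<eta> / (4 * (norm w + e))"
  have we: "0 < norm w + e" using e by (simp add: add_nonneg_pos)
  have \<tau>: "0 < \<tau>" using \<eta> we by (simp add: \<tau>_def)
  have "\<eta> / (4 * k) * k = \<eta> / 4" if "0 < k" for k using that by simp
  from this[OF we] have \<tau>we: "\<tau> * (norm w + e) = \<eta> / 4" unfolding \<tau>_def .
  have "((\<lambda>n. (h n)\<^sup>2) \<longlongrightarrow> 0) F" using tendsto_power[OF h_lim, of 2] by simp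
  then have 1: "eventually (\<lambda>n. (h n)\<^sup>2 < \<eta>0 / 2) F"
    by (rule order_tendstoD) (use \<eta>0 in simp)
  have 2: "eventually (\<lambda>n. dist (coords c n t) z0 < \<eta> / 2) F"
    unfolding z0_def by (rule tendstoD[OF tendsto_coords[OF c]]) (use \<eta> in simp)
  have "eventually (\<lambda>n. \<forall>r. \<bar>r - t\<bar> \<le> \<tau> \<longrightarrow>
    fst (\<gamma> n r) \<in> K \<and> norm (coords c n r - coords c n t - (r - t) *\<^sub>R w) \<le> e * \<bar>r - t\<bar>) F"
    using 1 2 eventually_in_chart[OF c]
  proof eventually_elim
    case (elim n)
    show ?case
    proof (intro allI impI)
      fix r assume r: "\<bar>r - t\<bar> \<le> \<tau>"
      \<comment> \<open>Affine time change from \<open>t\<close> at \<open>v = 0\<close> to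
        \<open>r\<close> at \<open>v = 1\<close>; it treats times before and after \<open>t\<close>
        together.\<close>
      let ?p = "\<lambda>v. t + v * (r - t)"
      let ?D = "\<lambda>v. (r - t) *\<^sub>R field c ((h n)\<^sup>2) (coords c n (?p v))"
      have near: "norm (field c ((h n)\<^sup>2) z - w) \<le> e" if "dist z z0 < \<eta>" for z
      proof -
        have "dist ((h n)\<^sup>2, z) (0, z0) \<le> dist ((h n)\<^sup>2) 0 + dist z z0"
          unfolding dist_Pair_Pair by (rule sqrt_sum_squares_le_sum) auto
        also have "\<dots> < \<eta>0" using that elim(1) by (simp add: \<eta>_def)
        finally show ?thesis using \<eta>0(2) by (fastforce simp: dist_norm)
      qed
      have der: "((\<lambda>v. coords c n (?p v)) has_vector_derivative ?D v) (at v)"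
        if "fst (\<gamma> n (?p v)) \<in> fst c" for v
      proof -
        have "(?p has_vector_derivative (r - t)) (at v)"
          unfolding has_vector_derivative_def by (auto intro!: derivative_eq_intros)
        from vector_diff_chain_at[OF this coords_derivative[OF c(1) that]]
        show ?thesis by (simp add: o_def)
      qed
      have "fst (\<gamma> n (?p 1)) \<in> K \<and>
        norm (coords c n (?p 1) - coords c n (?p 0) - (r - t) *\<^sub>R w) \<le> e * \<bar>r - t\<bar>"
      proof (rule stays_in_chart_ball[where x = "\<lambda>v. fst (\<gamma> n (?p v))" and W = "fst c"
            and ?z0.0 = z0 and \<eta> = \<eta> and D = ?D])
        have "continuous_on UNIV (fst \<circ> \<gamma> n)" using curve[of n] unfolding ham_curve_def by blast
        then have "continuous_on UNIV (\<lambda>v. (fst \<circ> \<gamma> n) (?p v))"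
          by (rule continuous_on_compose2) (auto intro!: continuous_intros)
        then show "continuous_on UNIV (\<lambda>v. fst (\<gamma> n (?p v)))" by simp
        show "open (fst c)" using chart(1)[OF c(1)] .
        show "compact K" "K \<subseteq> fst c" using K .
        show "0 < \<eta>" using \<eta> .
        show "fst (\<gamma> n (?p 0)) \<in> fst c" using elim by simp
        show "dist (coords c n (?p 0)) z0 \<le> \<eta> / 2" using elim by simp
        fix v
        assume W: "fst (\<gamma> n (?p v)) \<in> fst c"
        show "isCont (\<lambda>v. coords c n (?p v)) v"
          using der[OF W] has_vector_derivative_continuous by blast
        show "fst (\<gamma> n (?p v)) \<in> K" if "dist (coords c n (?p v)) z0 \<le> 3 * \<eta> / 4"
        proof -
          have "dist (snd c (fst (\<gamma> n (?p v)))) (fst z0) \<le> 3 * \<eta> / 4"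
            using that dist_fst_le[of "coords c n (?p v)" z0] by (simp add: coords_def)
          then have "snd c (fst (\<gamma> n (?p v))) \<in> cball (fst z0) (3 * \<eta> / 4)" by (simp add: dist_commute)
          then have "chart_inv c (snd c (fst (\<gamma> n (?p v)))) \<in> K" unfolding K_def by (rule imageI)
          then show ?thesis unfolding chart(5)[OF c(1) W] .
        qed
        show "((\<lambda>v. coords c n (?p v)) has_vector_derivative ?D v) (at v) \<and>
            norm (?D v - (r - t) *\<^sub>R w) \<le> e * \<bar>r - t\<bar>" if "dist (coords c n (?p v)) z0 < \<eta>"
          using der[OF W] near[OF that]
          by (simp add: scaleR_diff_right[symmetric] mult.commute[of e] mult_left_mono)
      next
        have "norm ((r - t) *\<^sub>R w) + e * \<bar>r - t\<bar> = \<bar>r - t\<bar> * (norm w + e)"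
          by (simp only: norm_scaleR real_norm_def distrib_left mult.commute[of e])
        also have "\<dots> \<le> \<tau> * (norm w + e)" using r we by (intro mult_right_mono) auto
        also have "\<dots> = \<eta> / 4" by (rule \<tau>we)
        finally show "norm ((r - t) *\<^sub>R w) + e * \<bar>r - t\<bar> \<le> \<eta> / 4" .
      qed
      then show "fst (\<gamma> n r) \<in> K \<and> norm (coords c n r - coords c n t - (r - t) *\<^sub>R w) \<le> e * \<bar>r - t\<bar>"
        by simp
    qed
  qed
  then show ?thesis using \<tau> K by blast
qed

text \<open>The non-strict bounds survive the limit. Since \<open>K\<close> is closed and inside the
  chart domain, the limit point at time \<open>r\<close> is still over \<open>c\<close>, where
  coordinates converge.\<close>

lemma limit_curve_linearization:
  assumes c: "c \<in> A" "limit_point t \<in> fst c" and e: "0 < e"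
  shows "\<exists>\<tau>>0. \<forall>r. \<bar>r - t\<bar> \<le> \<tau> \<longrightarrow> limit_point r \<in> fst c \<and>
    norm (cot_coords c (limit_curve r) - cot_coords c (limit_curve t)
      - (r - t) *\<^sub>R field c 0 (cot_coords c (limit_curve t))) \<le> e * \<bar>r - t\<bar>"
proof -
  let ?w = "field c 0 (cot_coords c (limit_curve t))"
  obtain \<tau> K where \<tau>: "\<tau> > 0" and K: "compact K" "K \<subseteq> fst c"
    and ev: "eventually (\<lambda>n. \<forall>r. \<bar>r - t\<bar> \<le> \<tau> \<longrightarrow>
      fst (\<gamma> n r) \<in> K \<and> norm (coords c n r - coords c n t - (r - t) *\<^sub>R ?w) \<le> e * \<bar>r - t\<bar>) F"
    using coords_linearization[OF assms] by blast
  have "limit_point r \<in> fst c \<and>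
    norm (cot_coords c (limit_curve r) - cot_coords c (limit_curve t) - (r - t) *\<^sub>R ?w) \<le> e * \<bar>r - t\<bar>"
    if r: "\<bar>r - t\<bar> \<le> \<tau>" for r
  proof -
    have "eventually (\<lambda>n. fst (\<gamma> n r) \<in> K) F" using ev by eventually_elim (use r in blast)
    then have "limit_point r \<in> K"
      using Lim_in_closed_set[OF compact_imp_closed[OF K(1)] _ F_nonbot tendsto_limit_point] by blast
    then have in_c: "limit_point r \<in> fst c" using K by blast
    have "((\<lambda>n. norm (coords c n r - coords c n t - (r - t) *\<^sub>R ?w)) \<longlongrightarrow>
      norm (cot_coords c (limit_curve r) - cot_coords c (limit_curve t) - (r - t) *\<^sub>R ?w)) F"
      by (intro tendsto_norm tendsto_diff tendsto_coords tendsto_const c in_c)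
    moreover have "eventually (\<lambda>n. norm (coords c n r - coords c n t - (r - t) *\<^sub>R ?w) \<le> e * \<bar>r - t\<bar>) F"
      using ev by eventually_elim (use r in blast)
    ultimately show ?thesis using tendsto_upperbound[OF _ _ F_nonbot] in_c by blast
  qed
  then show ?thesis using \<tau> by blast
qed

lemma limit_curve_derivative:
  assumes c: "c \<in> A" "limit_point t \<in> fst c"
  shows "((cot_coords c \<circ> limit_curve) has_vector_derivative
    field c 0 (cot_coords c (limit_curve t))) (at t)"
  unfolding has_vector_derivative_def has_derivative_at_alt
proof (intro conjI allI impI)
  show "bounded_linear (\<lambda>s. s *\<^sub>R field c 0 (cot_coords c (limit_curve t)))"
    by (rule bounded_linear_scaleR_left)
  fix e :: real assume "0 < e"
  from limit_curve_linearization[OF c this]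
  show "\<exists>d>0. \<forall>y. norm (y - t) < d \<longrightarrow>
      norm ((cot_coords c \<circ> limit_curve) y - (cot_coords c \<circ> limit_curve) t
        - (y - t) *\<^sub>R field c 0 (cot_coords c (limit_curve t))) \<le> e * norm (y - t)"
    by (metis comp_apply less_imp_le real_norm_def)
qed

lemma isCont_limit_point: "isCont limit_point t"
proof -
  define c where "c = chart_at A (limit_point t)"
  have c: "c \<in> A" "limit_point t \<in> fst c" using chart_at by (auto simp: c_def)
  obtain \<tau> where \<tau>: "\<tau> > 0" "\<And>r. \<bar>r - t\<bar> \<le> \<tau> \<Longrightarrow> limit_point r \<in> fst c"
    using limit_curve_linearization[OF c zero_less_one] by blast
  have "isCont (cot_coords c \<circ> limit_curve) t"
    using limit_curve_derivative[OF c] has_vector_derivative_continuous by blast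
  then have "isCont (\<lambda>r. snd c (limit_point r)) t"
    using continuous_fst by (fastforce simp: cot_coords_def limit_curve_def o_def)
  moreover have "isCont (chart_inv c) (snd c (limit_point t))"
    using chart(2,4)[OF c(1)] c(2) continuous_on_eq_continuous_at by blast
  ultimately have "isCont (\<lambda>r. chart_inv c (snd c (limit_point r))) t" by (rule isCont_o2)
  moreover have e: "eventually (\<lambda>r. chart_inv c (snd c (limit_point r)) = limit_point r) (nhds t)"
    unfolding eventually_nhds_metric
    using \<tau> chart(5)[OF c(1)] by (intro exI[of _ \<tau>]) (auto simp: dist_real_def)
  ultimately show ?thesis using isCont_cong[OF e] by simp
qed

text \<open>With \<open>s = 0\<close> the limiting field is that of the dual norm; the constant norm
  1 keeps the curve off the zero section.\<close>

lemma limit_curve_geodesic: "ham_curve A (cotangent_nonzero A) (conorm A G) limit_curve"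
  unfolding ham_curve_def
proof (intro conjI allI ballI impI)
  show "range limit_curve \<subseteq> cotangent_nonzero A"
  proof (rule image_subsetI)
    fix t
    have "snd (limit_curve t) \<noteq> (\<lambda>_. 0)"
      using conorm_limit_curve[of t] unfolding conorm_def Let_def by auto
    then show "limit_curve t \<in> cotangent_nonzero A"
      using limit_curve_cotangent unfolding cotangent_nonzero_def by blast
  qed
  show "continuous_on UNIV (fst \<circ> limit_curve)"
    using isCont_limit_point
    by (simp add: o_def limit_curve_def continuous_at_imp_continuous_on)
  fix t c assume c: "c \<in> A" "fst (limit_curve t) \<in> fst c"
  then have c': "limit_point t \<in> fst c" by (simp add: limit_curve_def)
  have "ham_field A (hamiltonian V 0) c (cot_coords c (limit_curve t)) = field c 0 (cot_coords c (limit_curve t))"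
    by (rule ham_field_hamiltonian[OF V_smooth_function c(1)])
      (use c energy_limit_curve[OF c(1) c'] in \<open>simp_all add: cot_coords_def\<close>)
  then show "((cot_coords c \<circ> limit_curve) has_vector_derivative
      ham_field A (conorm A G) c (cot_coords c (limit_curve t))) (at t)"
    using limit_curve_derivative[OF c(1) c'] by (simp add: conorm_eq_hamiltonian[of V])
qed

section \<open>Limits at the hitting times\<close>

text \<open>Convergence at each fixed time does not suffice for times that vary with
  \<open>n\<close>. The linear approximation, uniform in \<open>n\<close>, controls the change
  between \<open>t\<close> and \<open>\<theta> n\<close>; tolerance 1 is enough since the time
  difference tends to 0.\<close>

lemma eventually_near_limit_point:
  assumes \<theta>: "(\<theta> \<longlongrightarrow> t) F" and N: "open N" "limit_point t \<in> N"
  shows "eventually (\<lambda>n. fst (\<gamma> n (\<theta> n)) \<in> N) F"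
proof -
  define c where "c = chart_at A (limit_point t)"
  have c: "c \<in> A" "limit_point t \<in> fst c" using chart_at by (auto simp: c_def)
  let ?w = "field c 0 (cot_coords c (limit_curve t))"
  obtain \<tau> K where \<tau>: "\<tau> > 0" and K: "K \<subseteq> fst c"
    and ev: "eventually (\<lambda>n. \<forall>r. \<bar>r - t\<bar> \<le> \<tau> \<longrightarrow>
      fst (\<gamma> n r) \<in> K \<and> norm (coords c n r - coords c n t - (r - t) *\<^sub>R ?w) \<le> 1 * \<bar>r - t\<bar>) F"
    using coords_linearization[OF c zero_less_one] by blast
  have near: "eventually (\<lambda>n. \<bar>\<theta> n - t\<bar> < \<tau>) F"
    using tendstoD[OF \<theta> \<tau>] by (simp add: dist_real_def)
  have inc: "eventually (\<lambda>n. fst (\<gamma> n (\<theta> n)) \<in> fst c) F"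
    using ev near by eventually_elim (use K in force)
  have small: "eventually (\<lambda>n. norm (coords c n (\<theta> n) - coords c n t - (\<theta> n - t) *\<^sub>R ?w) \<le> \<bar>\<theta> n - t\<bar>) F"
    using ev near by eventually_elim force
  have "((\<lambda>n. \<bar>\<theta> n - t\<bar>) \<longlongrightarrow> 0) F"
    using \<theta> by (simp add: tendsto_rabs_zero LIM_zero)
  then have "((\<lambda>n. coords c n (\<theta> n) - coords c n t - (\<theta> n - t) *\<^sub>R ?w) \<longlongrightarrow> 0) F"
    by (rule Lim_null_comparison[OF small])
  then have "((\<lambda>n. (coords c n (\<theta> n) - coords c n t - (\<theta> n - t) *\<^sub>R ?w) + coords c n t + (\<theta> n - t) *\<^sub>R ?w)
      \<longlongrightarrow> 0 + cot_coords c (limit_curve t) + (t - t) *\<^sub>R ?w) F"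
    by (intro tendsto_add tendsto_coords c tendsto_scaleR tendsto_const tendsto_diff \<theta>)
  then have "((\<lambda>n. coords c n (\<theta> n)) \<longlongrightarrow> cot_coords c (limit_curve t)) F" by simp
  from tendsto_fst[OF this]
  have "((\<lambda>n. snd c (fst (\<gamma> n (\<theta> n)))) \<longlongrightarrow> snd c (limit_point t)) F"
    by (simp add: coords_def cot_coords_def limit_curve_def)
  then have "eventually (\<lambda>n. snd c (fst (\<gamma> n (\<theta> n))) \<in> snd c ` (fst c \<inter> N)) F"
    by (rule topological_tendstoD) (use open_chart_image[OF c(1) N(1)] c N in auto)
  with inc show ?thesis
  proof eventually_elim
    case (elim n)
    then obtain q where q: "q \<in> fst c" "q \<in> N" "snd c (fst (\<gamma> n (\<theta> n))) = snd c q" by blast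
    then have "chart_inv c (snd c (fst (\<gamma> n (\<theta> n)))) = chart_inv c (snd c q)" by simp
    then have "fst (\<gamma> n (\<theta> n)) = q"
      unfolding chart(5)[OF c(1) elim(1)] chart(5)[OF c(1) q(1)] .
    then show ?case using q(2) by simp
  qed
qed

end

section \<open>Transfer of the control condition to geodesics\<close>

theorem lemma1p4:
  fixes A :: "('m::t2_space, 'n::finite) chart set"
    and G :: "('m, 'n) chart \<Rightarrow> 'm \<Rightarrow> real^'n^'n"
    and V :: "'m \<Rightarrow> real"
    and \<omega> :: "'m set"
    and T \<epsilon> \<delta> :: real
  assumes "compact (UNIV :: 'm set)" and "connected (UNIV :: 'm set)"
    and "smooth_atlas A" and "riemannian_metric A G"
    and "smooth_function A V" and "\<And>x. 0 < V x" and "Linf_norm A V = 1"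
    and "open \<omega>" and "0 < T"
    and "GCC_V A G V \<omega> T"
    and "0 < \<epsilon>" and "0 < \<delta>"
  shows "GCC A G (nbhd_of A G \<omega> \<delta>) (T + \<epsilon>)"
  unfolding GCC_def
proof
  fix \<rho> assume \<rho>: "\<rho> \<in> cosphere A G"
  interpret riemannian_atlas A G by unfold_locales (use assms in auto)
  define h where "h n = 1 / real (Suc n)" for n
  have h_pos: "0 < h n" for n by (simp add: h_def)
  have cot: "(fst \<rho>, \<lambda>c. snd \<rho> c /\<^sub>R h n) \<in> cotangent A" for n
    using cotangent_scale \<rho> unfolding cosphere_def by blast
  have "\<exists>\<gamma> t. ham_curve A (cotangent A) (q_ham A G V) \<gamma> \<and> \<gamma> 0 = (fst \<rho>, \<lambda>c. snd \<rho> c /\<^sub>R h n)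
      \<and> 0 < t \<and> t < T \<and> fst (\<gamma> t) \<in> \<omega>" for n
    using assms(10) cot[of n] unfolding GCC_V_def ham_flow_def by fastforce
  then obtain \<gamma> \<theta> where \<gamma>: "\<And>n. ham_curve A (cotangent A) (q_ham A G V) (\<gamma> n)"
      "\<And>n. \<gamma> n 0 = (fst \<rho>, \<lambda>c. snd \<rho> c /\<^sub>R h n)"
    and \<theta>: "\<And>n. 0 < \<theta> n" "\<And>n. \<theta> n < T" "\<And>n. fst (\<gamma> n (\<theta> n)) \<in> \<omega>"
    by metis
  obtain F :: "nat filter" where F: "F \<le> sequentially" "ultra F"
    using ultra_exists[of sequentially] by auto
  have h_lim: "(h \<longlongrightarrow> 0) F"
    using tendsto_mono[OF F(1) LIMSEQ_Suc[OF lim_1_over_n]] by (simp add: h_def[abs_def])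
  interpret high_frequency_curves A G V h F \<rho> \<gamma>
    by unfold_locales (use assms F h_lim h_pos \<rho> \<gamma> in auto)
  \<comment> \<open>The hitting times are in the open interval, but their limit may be 0 or
    \<open>T\<close>.\<close>
  have "eventually (\<lambda>n. \<theta> n \<in> {0..T}) F"
    using \<theta> by (intro always_eventually) (auto simp: less_imp_le)
  then obtain t where t: "0 \<le> t" "t \<le> T" "(\<theta> \<longlongrightarrow> t) F"
    using ultra_compact_limit[OF F compact_Icc] by fastforce
  obtain N where N: "open N" "limit_point t \<in> N" "\<And>a b. a \<in> N \<Longrightarrow> b \<in> N \<Longrightarrow> riem_dist A G a b < \<delta>"
    using locally_riem_dist_small[OF assms(12)] by metis
  \<comment> \<open>At its hitting time some rescaled curve is both in \<open>\<omega>\<close> and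
    in \<open>N\<close>, so \<open>\<omega>\<close> meets the small neighbourhood of the limit
    point.\<close>
  obtain y where y: "y \<in> \<omega>" "y \<in> N"
    using eventually_happens'[OF F_nonbot eventually_near_limit_point[OF t(3) N(1,2)]] \<theta>(3) by blast
  have "eventually (\<lambda>s. limit_point s \<in> N) (nhds t)"
    using isCont_limit_point[of t] N unfolding isCont_def tendsto_at_iff_tendsto_nhds
    by (auto dest: topological_tendstoD)
  then obtain d where d: "d > 0" "\<And>s. dist s t < d \<Longrightarrow> limit_point s \<in> N"
    unfolding eventually_nhds_metric by blast
  \<comment> \<open>Later than \<open>t\<close>, so positive even if \<open>t = 0\<close>;
    \<open>\<epsilon> / 2\<close> keeps it below \<open>T + \<epsilon>\<close>, and
    \<open>d / 2\<close> keeps the geodesic in \<open>N\<close>, within \<open>\<delta>\<close> of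
    \<open>y\<close>.\<close>
  define s where "s = t + min (d / 2) (\<epsilon> / 2)"
  have s: "0 < s" "s < T + \<epsilon>" "limit_point s \<in> N"
    using t d assms(11) by (auto simp: s_def dist_real_def)
  have "riem_setdist A G (limit_point s) \<omega> \<le> ereal (riem_dist A G (limit_point s) y)"
    unfolding riem_setdist_def by (rule INF_lower) (rule y)
  also have "\<dots> < ereal \<delta>" using N(3) s y by simp
  finally have "limit_point s \<in> nbhd_of A G \<omega> \<delta>" unfolding nbhd_of_def by simp
  then show "\<exists>t\<in>{0<..<T + \<epsilon>}. \<exists>\<sigma>. ham_flow A (cotangent_nonzero A) (conorm A G) t \<rho> \<sigma>
      \<and> fst \<sigma> \<in> nbhd_of A G \<omega> \<delta>"
    using limit_curve_geodesic limit_curve_start s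
    by (intro bexI[of _ s] exI[of _ "limit_curve s"]) (auto simp: ham_flow_def limit_curve_def)
qed

end
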